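(* Let $n\ge3$, let $$W_n=\{\omega\in\mathbb{Q}\mid \exists\, F\in\mathcal{I}_n,\ F\neq0,\ \text{a relative invariant with } \operatorname{wt}(F)=\omega\}$$ be the additive group of all possible weights of first-order relative joint projective invariants for $n$ points, and let $g=\gcd(n,3)$. Then $$W_n=\tfrac1g\mathbb{Z},$$ and hence $\mathcal{I}_n=\mathcal{I}_{n,0}(z_n)$.
   Context: Let $J_1^{(n)}=\mathbb{R}(x_1,y_1,p_1,q_1,\dots,x_n,y_n,p_n,q_n)$ be the field of rational functions in $4n$ independent variables; $(x_i,y_i)$ is thought of as a point of the plane and $(p_i,q_i)$ as the gradient at that point of a function $u$. Action of $PGL(3,\mathbb{R})$: for the class of an invertible matrix with rows $(a_1,a_2,a_3),(b_1,b_2,b_3),(c_1,c_2,c_3)$ and determinant $D$, the projective transformation is $T(x,y)=\left(\frac{a_1x+a_2y+a_3}{c_1x+c_2y+c_3},\frac{b_1x+b_2y+b_3}{c_1x+c_2y+c_3}\right)$. It acts diagonally: $(x_i,y_i)\mapsto T(x_i,y_i)$ for every $i$, and on the gradients by the first prolongation of $u\mapsto u\circ T^{-1}$, i.e. the row vector $(p_i,q_i)$ is sent to $(p_i,q_i)\,\bigl(DT(x_i,y_i)\bigr)^{-1}$, where $DT$ is the $2\times2$ Jacobian matrix of $T$. The total Jacobian is $$J(T)=\prod_{i=1}^n\frac{D}{(c_1x_i+c_2y_i+c_3)^3}.$$ An element $F\in J_1^{(n)}$ is a relative first-order joint projective invariant of weight $\omega\in\mathbb{Q}$ (written $\operatorname{wt}(F)=\omega$)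 if, for every $T\in PGL(3,\mathbb{R})$, replacing all variables by their images under $T$ turns $F$ into $J(T)^{\omega}F$ (wherever both sides are defined as real numbers; odd roots are real odd roots). It is absolute if $\omega=0$. $\mathcal{I}_{n,0}$ is the field of absolute first-order joint projective invariants, and $\mathcal{I}_n$ is the field of relative first-order joint projective invariants, i.e. the subfield of $J_1^{(n)}$ generated by all relative ones. Set $\ell_i=(p_i,q_i,-p_ix_i-q_iy_i)$ and $\Delta_{ijk}=\det(\ell_i,\ell_j,\ell_k)$. The elements $z_n$ are: $z_3=\Delta_{123}$; $z_4=\Delta_{123}\Delta_{124}\Delta_{134}\Delta_{234}$; and for $n\ge5$, with $g=\gcd(n,3)$, $$z_n=\frac{\bigl(\prod_{i=5}^{n}\Delta_{12i}\bigr)^{3}(\Delta_{134}\Delta_{234})^{n-3}}{(\Delta_{123}\Delta_{124})^{2n-9}}\ \text{ if } g=1,\qquad z_n=\frac{\bigl(\prod_{i=5}^{n}\Delta_{12i}\bigr)(\Delta_{134}\Delta_{234})^{\frac n3-1}}{(\Delta_{123}\Delta_{124})^{\frac{2n}{3}-3}}\ \text{ if } g=3.$$ *)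

theory Defs
  imports
    "HOL-Analysis.Analysis"
    "HOL-Library.Poly_Mapping"
    "HOL-Computational_Algebra.Fraction_Field"
begin

datatype coord = Xc nat | Yc nat | Pc nat | Qc nat

text \<open>The order on \<open>coord\<close> has no mathematical role: the library proves that polynomials
  form an integral domain only for linearly ordered monomials.\<close>

primrec coord_index :: "coord \<Rightarrow> nat" where
  "coord_index (Xc i) = 4 * i"
| "coord_index (Yc i) = 4 * i + 1"
| "coord_index (Pc i) = 4 * i + 2"
| "coord_index (Qc i) = 4 * i + 3"

lemma coord_index_inj: "coord_index a = coord_index b \<Longrightarrow> a = b"
  by (cases a; cases b) (simp; presburger)+

instantiation coord :: linorder
begin

definition less_eq_coord :: "coord \<Rightarrow> coord \<Rightarrow> bool" where
  "a \<le> b \<longleftrightarrow> coord_index a \<le> coord_index b"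

definition less_coord :: "coord \<Rightarrow> coord \<Rightarrow> bool" where
  "a < b \<longleftrightarrow> coord_index a < coord_index b"

instance
  by standard (auto simp: less_eq_coord_def less_coord_def intro: coord_index_inj)

end

type_synonym mpoly = "(coord \<Rightarrow>\<^sub>0 nat) \<Rightarrow>\<^sub>0 real"
type_synonym ratfun = "mpoly fract"

definition const_fun :: "real \<Rightarrow> ratfun" where
  "const_fun c = Fract (Poly_Mapping.single 0 c) 1"

definition var_fun :: "coord \<Rightarrow> ratfun" where
  "var_fun v = Fract (Poly_Mapping.single (Poly_Mapping.single v 1) 1) 1"

definition is_subfield :: "'a::field set \<Rightarrow> bool" where
  "is_subfield K \<longleftrightarrow> 0 \<in> K \<and> 1 \<in> K \<and>
     (\<forall>a\<in>K. \<forall>b\<in>K. a + b \<in> K \<and> a * b \<in> K) \<and> (\<forall>a\<in>K. - a \<in> K \<and> inverse a \<in> K)"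

definition J1 :: "nat \<Rightarrow> ratfun set" where
  "J1 n = is_subfield hull (range const_fun \<union> (\<Union>i\<in>{1..n}. var_fun ` {Xc i, Yc i, Pc i, Qc i}))"

text \<open>A configuration \<open>(X, G)\<close> consists of points \<open>X i\<close> and gradients \<open>G i\<close>.\<close>

type_synonym config = "(nat \<Rightarrow> real^2) \<times> (nat \<Rightarrow> real^2)"

primrec coord_value :: "config \<Rightarrow> coord \<Rightarrow> real" where
  "coord_value c (Xc i) = fst c i $ 1"
| "coord_value c (Yc i) = fst c i $ 2"
| "coord_value c (Pc i) = snd c i $ 1"
| "coord_value c (Qc i) = snd c i $ 2"

definition eval_mpoly :: "mpoly \<Rightarrow> config \<Rightarrow> real" where
  "eval_mpoly f c =
     (\<Sum>m\<in>Poly_Mapping.keys f. Poly_Mapping.lookup f m *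
        (\<Prod>v\<in>Poly_Mapping.keys m. coord_value c v ^ Poly_Mapping.lookup m v))"

text \<open>\<open>has_value F c r\<close>: the rational function \<open>F\<close> is defined at \<open>c\<close>, with value \<open>r\<close>.\<close>

definition has_value :: "ratfun \<Rightarrow> config \<Rightarrow> real \<Rightarrow> bool" where
  "has_value F c r \<longleftrightarrow>
     (\<exists>a b. F = Fract a b \<and> eval_mpoly b c \<noteq> 0 \<and> r = eval_mpoly a c / eval_mpoly b c)"

definition homog :: "real^2 \<Rightarrow> real^3" where
  "homog z = vector [z $ 1, z $ 2, 1]"

text \<open>\<open>proj_denom A (x, y)\<close> is \<open>c\<^sub>1 x + c\<^sub>2 y + c\<^sub>3\<close>, where \<open>(c\<^sub>1, c\<^sub>2, c\<^sub>3)\<close> is the last row of \<open>A\<close>.\<close>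

definition proj_denom :: "real^3^3 \<Rightarrow> real^2 \<Rightarrow> real" where
  "proj_denom A z = (A *v homog z) $ 3"

definition proj_map :: "real^3^3 \<Rightarrow> real^2 \<Rightarrow> real^2" where
  "proj_map A z =
     vector [(A *v homog z) $ 1 / proj_denom A z, (A *v homog z) $ 2 / proj_denom A z]"

definition act :: "real^3^3 \<Rightarrow> config \<Rightarrow> config" where
  "act A c =
     (\<lambda>i. proj_map A (fst c i),
      \<lambda>i. snd c i v* matrix_inv (jacobian (proj_map A) (at (fst c i))))"

definition total_jacobian :: "nat \<Rightarrow> real^3^3 \<Rightarrow> config \<Rightarrow> real" where
  "total_jacobian n A c = (\<Prod>i=1..n. det A / proj_denom A (fst c i) ^ 3)"

text \<open>Rational powers of a nonzero real. In lowest terms, the exponent must have odd denominator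
  if the base is negative; \<open>root k\<close> is the real odd root in that case.\<close>

definition rat_power_defined :: "real \<Rightarrow> rat \<Rightarrow> bool" where
  "rat_power_defined x w \<longleftrightarrow> x > 0 \<or> (x < 0 \<and> odd (snd (quotient_of w)))"

definition rat_power :: "real \<Rightarrow> rat \<Rightarrow> real" where
  "rat_power x w = root (nat (snd (quotient_of w))) x powi fst (quotient_of w)"

text \<open>Projective transformations are represented by invertible matrices: \<open>proj_map A\<close> and
  \<open>total_jacobian n A\<close> are unchanged when \<open>A\<close> is multiplied by a nonzero scalar.\<close>

definition relative_invariant :: "nat \<Rightarrow> rat \<Rightarrow> ratfun \<Rightarrow> bool" where
  "relative_invariant n w F \<longleftrightarrow> F \<in> J1 n \<and>
     (\<forall>A c r s. invertible A \<longrightarrow> (\<forall>i\<in>{1..n}. proj_denom A (fst c i) \<noteq> 0) \<longrightarrow>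
        has_value F c r \<longrightarrow> has_value F (act A c) s \<longrightarrow>
        rat_power_defined (total_jacobian n A c) w \<longrightarrow>
        s = rat_power (total_jacobian n A c) w * r)"

definition absolute_invariants :: "nat \<Rightarrow> ratfun set" where
  "absolute_invariants n = {F. relative_invariant n 0 F}"

definition relative_invariant_field :: "nat \<Rightarrow> ratfun set" where
  "relative_invariant_field n = is_subfield hull {F. \<exists>w. relative_invariant n w F}"

definition weights :: "nat \<Rightarrow> rat set" where
  "weights n = {w. \<exists>F\<in>relative_invariant_field n. F \<noteq> 0 \<and> relative_invariant n w F}"

definition ell :: "nat \<Rightarrow> ratfun^3" where
  "ell i = vector [var_fun (Pc i), var_fun (Qc i), - var_fun (Pc i) * var_fun (Xc i) - var_fun (Qc i) * var_fun (Yc i)]"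

definition Delta :: "nat \<Rightarrow> nat \<Rightarrow> nat \<Rightarrow> ratfun" where
  "Delta i j k = det (vector [ell i, ell j, ell k] :: ratfun^3^3)"

text \<open>Only \<open>n \<ge> 3\<close> is meaningful; then no natural-number subtraction or division below truncates.\<close>

definition z_elem :: "nat \<Rightarrow> ratfun" where
  "z_elem n =
     (if n = 3 then Delta 1 2 3
      else if n = 4 then Delta 1 2 3 * Delta 1 2 4 * Delta 1 3 4 * Delta 2 3 4
      else if gcd n 3 = 1 then
        (\<Prod>i=5..n. Delta 1 2 i) ^ 3 * (Delta 1 3 4 * Delta 2 3 4) ^ (n - 3)
          / (Delta 1 2 3 * Delta 1 2 4) ^ (2 * n - 9)
      else
        (\<Prod>i=5..n. Delta 1 2 i) * (Delta 1 3 4 * Delta 2 3 4) ^ (n div 3 - 1)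
          / (Delta 1 2 3 * Delta 1 2 4) ^ (2 * n div 3 - 3))"

end

theory Submission
  imports Defs
begin

text \<open>Write $h_i = (x_i, y_i, 1)$ and let $d_i = c_1 x_i + c_2 y_i + c_3$ be the denominator of a projective
map with matrix $A$ at the $i$-th point. The map sends $h_i$ to $A h_i / d_i$. The covector
$\ell_i = (p_i, q_i, - p_i x_i - q_i y_i)$ is the line through the $i$-th point on which the
differential vanishes, and the chain rule for gradients takes the simple form
$\ell_i \mapsto d_i\, \ell_i A^{-1}$ (\<open>line_at_act\<close>). Hence $\Delta_{ijk}$ is multiplied by
$d_i d_j d_k / \det A = 1 / (\rho_i \rho_j \rho_k)$, where $\rho_i = \sqrt[3]{\det A} / d_i$ is the cube
root of the $i$-th factor of the total Jacobian. A product of powers of such determinants in which every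
index occurs $m$ times in total is therefore a relative invariant of weight $- m / 3$. With
$g = \gcd(n, 3)$, the element $z_n$ is such a product with $m = 3 / g$ (\<open>z_value_rescale\<close>), so its powers
realise every weight in $\frac 1 g \mathbb Z$.

No other weight occurs (\<open>relative_invariant_weight\<close>). Let $F \neq 0$ have weight $u / v$ in lowest terms.
Along the family of homologies with axis $x = 0$ and centre $(1, 0)$, with parameter $t$, the total Jacobian
is $t^n / \prod_i (1 + (t - 1) x_i)^3$, while the ratio of $F$ at the image of a fixed configuration to $F$ at
the configuration itself is a rational function of $t$. The $v$-th power of this ratio is the $u$-th power of
the total Jacobian, so the orders of that $u$-th power are divisible by $v$. At $t = 0$ the order is
$n u$; at a root of one of the factors in the denominator, for pairwise distinct abscissae, it is $- 3 u$.
Since $u$ and $v$ are coprime, $v$ divides $n$ and $3$, hence $g$.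

If $F$ has weight $k / g$, then $F z_n^k$ has weight $0$. This gives the description of the field of
relative invariants.

Invariance is an identity at every configuration where the two values exist, although sums, products and
quotients are computed from fixed fractions only where their denominators do not vanish. The criterion
\<open>relative_invariant_thirdI\<close> bridges this gap: every configuration with nonzero denominators
$d_i$ is a limit, along a segment, of configurations for which a given nonzero polynomial vanishes neither
there nor at the image, and both sides of the identity are continuous.\<close>

section \<open>Polynomials as functions on configurations\<close>

definition monomial_value :: "config \<Rightarrow> (coord \<Rightarrow>\<^sub>0 nat) \<Rightarrow> real" where
  "monomial_value c m = (\<Prod>v\<in>Poly_Mapping.keys m. coord_value c v ^ Poly_Mapping.lookup m v)"

lemma monomial_value_superset:
  assumes "finite V" "Poly_Mapping.keys m \<subseteq> V"
  shows "monomial_value c m = (\<Prod>v\<in>V. coord_value c v ^ Poly_Mapping.lookup m v)"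
  unfolding monomial_value_def
  by (rule prod.mono_neutral_left) (use assms in \<open>auto simp: in_keys_iff\<close>)

lemma monomial_value_0 [simp]: "monomial_value c 0 = 1"
  by (simp add: monomial_value_def)

lemma monomial_value_single [simp]:
  "monomial_value c (Poly_Mapping.single v k) = coord_value c v ^ k"
  by (cases "k = 0") (auto simp: monomial_value_def)

lemma monomial_value_add: "monomial_value c (m + m') = monomial_value c m * monomial_value c m'"
proof -
  let ?V = "Poly_Mapping.keys m \<union> Poly_Mapping.keys m'"
  have "Poly_Mapping.keys (m + m') \<subseteq> ?V"
    by (rule keys_add)
  then show ?thesis
    by (simp add: monomial_value_superset[of ?V] lookup_add power_add prod.distrib)
qed

lemma eval_mpoly_superset:
  assumes "finite M" "Poly_Mapping.keys f \<subseteq> M"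
  shows "eval_mpoly f c = (\<Sum>m\<in>M. Poly_Mapping.lookup f m * monomial_value c m)"
  unfolding eval_mpoly_def monomial_value_def
  by (rule sum.mono_neutral_left) (use assms in \<open>auto simp: in_keys_iff\<close>)

lemma eval_mpoly_single [simp]:
  "eval_mpoly (Poly_Mapping.single m a) c = a * monomial_value c m"
  by (subst eval_mpoly_superset[of "{m}"]) auto

lemma eval_mpoly_0 [simp]: "eval_mpoly 0 c = 0"
  by (simp add: eval_mpoly_def)

lemma eval_mpoly_1 [simp]: "eval_mpoly 1 c = 1"
  by (metis eval_mpoly_single monomial_value_0 mult.right_neutral single_one)

lemma eval_mpoly_add [simp]: "eval_mpoly (f + g) c = eval_mpoly f c + eval_mpoly g c"
proof -
  let ?M = "Poly_Mapping.keys f \<union> Poly_Mapping.keys g"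
  have "Poly_Mapping.keys (f + g) \<subseteq> ?M"
    by (rule keys_add)
  then show ?thesis
    by (simp add: eval_mpoly_superset[of ?M] lookup_add distrib_right sum.distrib)
qed

lemma eval_mpoly_uminus [simp]: "eval_mpoly (- f) c = - eval_mpoly f c"
  using eval_mpoly_add[of "- f" f c] by simp

lemma eval_mpoly_diff [simp]: "eval_mpoly (f - g) c = eval_mpoly f c - eval_mpoly g c"
  using eval_mpoly_add[of f "- g" c] by simp

lemma eval_mpoly_sum: "eval_mpoly (\<Sum>i\<in>I. f i) c = (\<Sum>i\<in>I. eval_mpoly (f i) c)"
  by (induction I rule: infinite_finite_induct) auto

lemma mpoly_sum_monomials:
  "f = (\<Sum>m\<in>Poly_Mapping.keys f. Poly_Mapping.single m (Poly_Mapping.lookup f m))" for f :: mpoly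
proof (rule poly_mapping_eqI)
  fix k
  have "(\<Sum>m\<in>Poly_Mapping.keys f. Poly_Mapping.lookup (Poly_Mapping.single m (Poly_Mapping.lookup f m)) k) =
        (\<Sum>m\<in>Poly_Mapping.keys f. if m = k then Poly_Mapping.lookup f k else 0)"
    by (rule sum.cong) (auto simp: lookup_single)
  also have "\<dots> = Poly_Mapping.lookup f k"
    by (auto simp: in_keys_iff)
  finally show "Poly_Mapping.lookup f k =
      Poly_Mapping.lookup (\<Sum>m\<in>Poly_Mapping.keys f. Poly_Mapping.single m (Poly_Mapping.lookup f m)) k"
    by (simp add: lookup_sum)
qed

lemma eval_mpoly_mult [simp]: "eval_mpoly (f * g) c = eval_mpoly f c * eval_mpoly g c"
proof -
  let ?F = "Poly_Mapping.keys f" and ?G = "Poly_Mapping.keys g"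
  let ?a = "Poly_Mapping.lookup f" and ?b = "Poly_Mapping.lookup g"
  have "f * g = (\<Sum>m\<in>?F. Poly_Mapping.single m (?a m)) * (\<Sum>m'\<in>?G. Poly_Mapping.single m' (?b m'))"
    using mpoly_sum_monomials[of f] mpoly_sum_monomials[of g] by (rule arg_cong2)
  also have "\<dots> = (\<Sum>m\<in>?F. \<Sum>m'\<in>?G. Poly_Mapping.single (m + m') (?a m * ?b m'))"
    by (simp only: sum_product mult_single)
  finally have "eval_mpoly (f * g) c =
      (\<Sum>m\<in>?F. \<Sum>m'\<in>?G. (?a m * monomial_value c m) * (?b m' * monomial_value c m'))"
    by (simp only: eval_mpoly_sum eval_mpoly_single monomial_value_add mult.assoc mult.left_commute mult.commute)
  also have "\<dots> = (\<Sum>m\<in>?F. ?a m * monomial_value c m) * (\<Sum>m'\<in>?G. ?b m' * monomial_value c m')"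
    by (simp only: sum_product)
  also have "\<dots> = eval_mpoly f c * eval_mpoly g c"
    by (simp only: eval_mpoly_superset[OF finite_keys subset_refl])
  finally show ?thesis .
qed

lemma eval_mpoly_prod: "eval_mpoly (\<Prod>i\<in>I. f i) c = (\<Prod>i\<in>I. eval_mpoly (f i) c)"
  by (induction I rule: infinite_finite_induct) auto

text \<open>Monomials are multiplicative characters for the coordinatewise product of configurations. Their linear
independence is Dedekind's argument.\<close>
definition config_mult :: "config \<Rightarrow> config \<Rightarrow> config" where
  "config_mult c d = (\<lambda>i. fst c i * fst d i, \<lambda>i. snd c i * snd d i)"

lemma monomial_value_config_mult:
  "monomial_value (config_mult c d) m = monomial_value c m * monomial_value d m"
proof -
  have "coord_value (config_mult c d) v = coord_value c v * coord_value d v" for v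
    by (cases v) (auto simp: config_mult_def)
  then show ?thesis
    by (simp add: monomial_value_def power_mult_distrib prod.distrib)
qed

lemma config_with_coords: "\<exists>c. \<forall>v. coord_value c v = f v"
proof -
  let ?c = "(\<lambda>i. vector [f (Xc i), f (Yc i)], \<lambda>i. vector [f (Pc i), f (Qc i)])"
  have "coord_value ?c v = f v" for v
    by (cases v) auto
  then show ?thesis by blast
qed

lemma monomial_values_separate:
  assumes "m \<noteq> m'"
  shows "\<exists>c. monomial_value c m \<noteq> monomial_value c m'"
proof -
  obtain v where v: "Poly_Mapping.lookup m v \<noteq> Poly_Mapping.lookup m' v"
    using assms by (auto simp: poly_mapping_eq_iff fun_eq_iff)
  obtain c where c: "\<And>w. coord_value c w = (if w = v then 2 else 1)"
    using config_with_coords[of "\<lambda>w. if w = v then 2 else 1"] by metis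
  have "monomial_value c k = 2 ^ Poly_Mapping.lookup k v" for k
  proof -
    have "monomial_value c k = (\<Prod>w\<in>insert v (Poly_Mapping.keys k). coord_value c w ^ Poly_Mapping.lookup k w)"
      by (rule monomial_value_superset) auto
    also have "\<dots> = (\<Prod>w\<in>insert v (Poly_Mapping.keys k). if w = v then 2 ^ Poly_Mapping.lookup k v else 1)"
      by (rule prod.cong) (simp_all add: c)
    also have "\<dots> = 2 ^ Poly_Mapping.lookup k v"
      by (subst prod.delta) simp_all
    finally show ?thesis .
  qed
  with v have "monomial_value c m \<noteq> monomial_value c m'"
    by (simp only: power_inject_exp) simp
  then show ?thesis ..
qed

lemma monomial_values_independent:
  assumes "finite M" "\<And>c. (\<Sum>m\<in>M. a m * monomial_value c m) = 0" "m \<in> M"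
  shows "a m = 0"
  using assms
proof (induction "card M" arbitrary: M a m rule: less_induct)
  case less
  \<comment> \<open>Translate the relation by a configuration \<open>d\<close> separating \<open>k\<close> from \<open>m\<close> and
    subtract a multiple of the original: the term of \<open>m\<close> cancels and that of \<open>k\<close> survives.\<close>
  have other: "a k = 0" if k: "k \<in> M" "k \<noteq> m" for k
  proof -
    obtain d where d: "monomial_value d k \<noteq> monomial_value d m"
      using monomial_values_separate[OF k(2)] by blast
    let ?b = "\<lambda>j. a j * (monomial_value d j - monomial_value d m)"
    have "(\<Sum>j\<in>M - {m}. ?b j * monomial_value c j) = 0" for c
    proof -
      have "(\<Sum>j\<in>M - {m}. ?b j * monomial_value c j) = (\<Sum>j\<in>M. ?b j * monomial_value c j)"
        by (rule sum.mono_neutral_left) (use less.prems in auto)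
      also have "\<dots> = (\<Sum>j\<in>M. a j * monomial_value (config_mult c d) j)
                      - monomial_value d m * (\<Sum>j\<in>M. a j * monomial_value c j)"
        unfolding sum_distrib_left sum_subtractf[symmetric] monomial_value_config_mult
        by (rule sum.cong) (auto simp: algebra_simps)
      finally show ?thesis
        by (simp add: less.prems(2))
    qed
    moreover have "card (M - {m}) < card M"
      using less.prems by (intro card_Diff1_less) auto
    ultimately have "?b k = 0"
      using less.prems(1) k by (intro less.hyps[of "M - {m}" ?b k]) simp_all
    then show ?thesis
      using d by simp
  qed
  have single_term: "(\<Sum>j\<in>M. a j * monomial_value c j) = a m * monomial_value c m" for c
  proof -
    have "(\<Sum>j\<in>M - {m}. a j * monomial_value c j) = 0"
      by (rule sum.neutral) (simp add: other)
    then show ?thesis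
      using sum.remove[OF less.prems(1,3), of "\<lambda>j. a j * monomial_value c j"] by simp
  qed
  obtain c :: config where "\<And>v. coord_value c v = 1"
    using config_with_coords[of "\<lambda>_. 1"] by blast
  then have "monomial_value c m = 1"
    by (simp add: monomial_value_def)
  with less.prems(2)[of c] single_term[of c] show ?case
    by simp
qed

lemma eval_mpoly_nonzero_ex:
  assumes "f \<noteq> 0"
  shows "\<exists>c. eval_mpoly f c \<noteq> 0"
proof (rule ccontr)
  assume "\<not> ?thesis"
  then have "eval_mpoly f c = 0" for c
    by blast
  then have "(\<Sum>m\<in>Poly_Mapping.keys f. Poly_Mapping.lookup f m * monomial_value c m) = 0" for c
    by (metis eval_mpoly_superset finite_keys subset_refl)
  then have "Poly_Mapping.lookup f m = 0" for m
    using monomial_values_independent[of "Poly_Mapping.keys f" "Poly_Mapping.lookup f" m]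
    by (cases "m \<in> Poly_Mapping.keys f") (auto simp: in_keys_iff)
  then show False
    using assms poly_mapping_eqI[of f 0] by simp
qed

section \<open>The projective action on points and lines\<close>
lemma proj_denom_eq: "proj_denom A z = A$3$1 * z$1 + A$3$2 * z$2 + A$3$3"
  by (simp add: proj_denom_def homog_def matrix_vector_mult_def sum_3)

lemma homog_image_eq: "(A *v homog z) $ k = A$k$1 * z$1 + A$k$2 * z$2 + A$k$3"
  by (simp add: homog_def matrix_vector_mult_def sum_3)

lemma homog_proj_map:
  assumes "proj_denom A z \<noteq> 0"
  shows "homog (proj_map A z) = (1 / proj_denom A z) *\<^sub>R (A *v homog z)"
  using assms by (simp add: vec_eq_iff forall_3 homog_def proj_map_def proj_denom_def)

text \<open>The quotient rule for the two coordinates of a projective map, whose numerators are the first two entries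
of \<open>w\<close> and whose common denominator is \<open>d\<close>.\<close>
definition proj_jacobian :: "real^3^3 \<Rightarrow> real^2 \<Rightarrow> real^2^2" where
  "proj_jacobian A z =
    (let d = proj_denom A z; w = A *v homog z in
     vector [vector [(A$1$1 * d - w$1 * A$3$1) / d^2, (A$1$2 * d - w$1 * A$3$2) / d^2],
             vector [(A$2$1 * d - w$2 * A$3$1) / d^2, (A$2$2 * d - w$2 * A$3$2) / d^2]])"

lemma jacobian_proj_map:
  assumes "proj_denom A z \<noteq> 0"
  shows "jacobian (proj_map A) (at z) = proj_jacobian A z"
proof -
  have affine: "((\<lambda>z. (A *v homog z) $ k) has_derivative (\<lambda>h. A$k$1 * h$1 + A$k$2 * h$2)) (at z)" for k
    unfolding homog_image_eq
    by (rule has_derivative_eq_rhs, (rule derivative_intros bounded_linear.has_derivative[OF bounded_linear_vec_nth])+) simp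
  have quotient: "((\<lambda>z. (A *v homog z) $ k / proj_denom A z) has_derivative
      (\<lambda>h. ((A$k$1 * h$1 + A$k$2 * h$2) * proj_denom A z
           - (A *v homog z) $ k * (A$3$1 * h$1 + A$3$2 * h$2)) / (proj_denom A z * proj_denom A z))) (at z)" for k
    unfolding proj_denom_def
    by (rule has_derivative_divide'[OF affine affine]) (use assms in \<open>simp add: proj_denom_def\<close>)
  define d w where "d = proj_denom A z" and "w = A *v homog z"
  have "proj_jacobian A z = vector
      [vector [(A$1$1 * d - w$1 * A$3$1) / (d * d), (A$1$2 * d - w$1 * A$3$2) / (d * d)],
       vector [(A$2$1 * d - w$2 * A$3$1) / (d * d), (A$2$2 * d - w$2 * A$3$2) / (d * d)]]"
    by (simp add: proj_jacobian_def Let_def d_def w_def power2_eq_square)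
  then have rows:
    "(proj_jacobian A z *v h) $ 1 = ((A$1$1 * h$1 + A$1$2 * h$2) * d - w$1 * (A$3$1 * h$1 + A$3$2 * h$2)) / (d * d)"
    "(proj_jacobian A z *v h) $ 2 = ((A$2$1 * h$1 + A$2$2 * h$2) * d - w$2 * (A$3$1 * h$1 + A$3$2 * h$2)) / (d * d)" for h
    using assms by (simp_all add: matrix_vector_mult_def sum_2 d_def[symmetric] field_simps)
  have comp: "((\<lambda>z. proj_map A z $ i) has_derivative (\<lambda>h. (proj_jacobian A z *v h) $ i)) (at z)" for i
  proof -
    consider "i = 1" | "i = 2"
      using exhaust_2 by blast
    then show ?thesis
    proof cases
      case 1
      with quotient[of 1] show ?thesis
        by (simp only: rows) (simp add: proj_map_def d_def w_def)
    next
      case 2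
      with quotient[of 2] show ?thesis
        by (simp only: rows) (simp add: proj_map_def d_def w_def)
    qed
  qed
  have "(proj_map A has_derivative (\<lambda>h. proj_jacobian A z *v h)) (at z)"
    unfolding has_derivative_componentwise_within[where f = "proj_map A"]
    using comp by (auto simp: Basis_vec_def inner_axis)
  then have "frechet_derivative (proj_map A) (at z) = (\<lambda>h. proj_jacobian A z *v h)"
    by (rule frechet_derivative_at[symmetric])
  then show ?thesis
    by (simp add: jacobian_def)
qed

lemma det_proj_jacobian:
  assumes "proj_denom A z \<noteq> 0"
  shows "det (proj_jacobian A z) = det A / proj_denom A z ^ 3"
proof -
  define d where "d = proj_denom A z"
  define u v where "u = (A *v homog z)$1" "v = (A *v homog z)$2"
  have eq: "(A$1$1 * d - u * A$3$1) * (A$2$2 * d - v * A$3$2)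
      - (A$1$2 * d - u * A$3$2) * (A$2$1 * d - v * A$3$1) = d * det A"
    unfolding d_def u_v_def proj_denom_eq homog_image_eq det_3 by (simp add: algebra_simps)
  have "det (proj_jacobian A z) = ((A$1$1 * d - u * A$3$1) * (A$2$2 * d - v * A$3$2)
      - (A$1$2 * d - u * A$3$2) * (A$2$1 * d - v * A$3$1)) / d^4"
    by (simp add: det_2 proj_jacobian_def Let_def d_def u_v_def diff_divide_distrib[symmetric] power4_eq_xxxx power2_eq_square mult.assoc)
  also have "\<dots> = d * det A / d ^ 4"
    by (simp only: eq)
  also have "\<dots> = det A / d ^ 3"
    using assms by (simp add: d_def power4_eq_xxxx power3_eq_cube)
  finally show ?thesis
    by (simp add: d_def)
qed

text \<open>The values of the vectors \<open>ell\<close>, for which the action is linear up to a scalar.\<close>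
definition line_at :: "config \<Rightarrow> nat \<Rightarrow> real^3" where
  "line_at c i = vector [snd c i $ 1, snd c i $ 2, - snd c i $ 1 * fst c i $ 1 - snd c i $ 2 * fst c i $ 2]"

lemma invertible_matrix_inv:
  assumes "invertible A"
  shows "A ** matrix_inv A = mat 1" "matrix_inv A ** A = mat 1"
  using someI_ex[OF assms[unfolded invertible_def]] by (simp_all add: matrix_inv_def)

lemma vector_matrix_inv_eqI:
  fixes M :: "real^'n^'n"
  assumes "invertible M" "g v* M = u"
  shows "u v* matrix_inv M = g"
  using assms by (auto simp: vector_matrix_mul_assoc invertible_matrix_inv)

text \<open>The covector $\ell' = d\, \ell A^{-1}$ annihilates the image of the point because $\ell$ annihilates the
point, so its third entry is determined by the first two. These two are the new gradient: by
$\ell' A = d\, \ell$ and $\ell' \cdot A h = 0$, multiplying them by the Jacobian matrix of the map returns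
the old gradient.\<close>
lemma line_at_act:
  assumes A: "invertible A" and d: "proj_denom A (fst c i) \<noteq> 0"
  shows "line_at (act A c) i = proj_denom A (fst c i) *\<^sub>R (line_at c i v* matrix_inv A)"
proof -
  define z where "z = fst c i"
  define d where "d = proj_denom A z"
  define w where "w = A *v homog z"
  define l where "l = line_at c i"
  define l' where "l' = d *\<^sub>R (l v* matrix_inv A)"
  have d0: "d \<noteq> 0" and w3: "w $ 3 = d"
    using assms(2) by (simp_all add: d_def z_def w_def proj_denom_def)
  have l'A: "l' v* A = d *\<^sub>R l"
    by (simp add: l'_def scaleR_vector_matrix_assoc vector_matrix_mul_assoc invertible_matrix_inv A)
  then have l'A_nth: "l'$1 * A$1$k + l'$2 * A$2$k + l'$3 * A$3$k = d * l$k" for k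
    by (simp add: vec_eq_iff vector_matrix_mult_def sum_3 mult_ac)
  have "l \<bullet> homog z = 0"
    by (simp add: l_def line_at_def homog_def inner_vec_def sum_3 z_def algebra_simps)
  moreover have "l' \<bullet> w = d * (l \<bullet> homog z)"
    unfolding w_def dot_lmul_matrix[symmetric] l'A by simp
  ultimately have l'w: "l'$1 * w$1 + l'$2 * w$2 + l'$3 * d = 0"
    by (simp add: inner_vec_def sum_3 w3)
  define g :: "real^2" where "g = vector [l'$1, l'$2]"
  have "l'$1 * (A$1$k * d - w$1 * A$3$k) + l'$2 * (A$2$k * d - w$2 * A$3$k) = d^2 * l$k" for k
  proof -
    have "l'$1 * (A$1$k * d - w$1 * A$3$k) + l'$2 * (A$2$k * d - w$2 * A$3$k) =
        d * (l'$1 * A$1$k + l'$2 * A$2$k + l'$3 * A$3$k) - A$3$k * (l'$1 * w$1 + l'$2 * w$2 + l'$3 * d)"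
      by (simp add: algebra_simps)
    then show ?thesis
      unfolding l'A_nth l'w by (simp add: power2_eq_square)
  qed
  then have "g v* proj_jacobian A z = snd c i"
    using d0 
    by (simp add: vec_eq_iff forall_2 vector_matrix_mult_def sum_2 g_def proj_jacobian_def Let_def
        d_def[symmetric] w_def[symmetric] add_divide_distrib[symmetric] mult_ac l_def line_at_def)
  moreover have "invertible (proj_jacobian A z)"
    using A d0 det_proj_jacobian[of A z] by (simp add: invertible_det_nz d_def)
  ultimately have "snd (act A c) i = g"
    using jacobian_proj_map[of A z] d0 by (simp add: act_def z_def d_def vector_matrix_inv_eqI)
  moreover have "fst (act A c) i = vector [w$1 / d, w$2 / d]"
    by (simp add: act_def proj_map_def z_def w_def d_def)
  ultimately have "line_at (act A c) i = l'"
    using l'w d0 by (simp add: line_at_def vec_eq_iff forall_3 g_def field_simps)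
  then show ?thesis
    by (simp add: l'_def l_def d_def z_def)
qed

lemma line_at_nth [simp]:
  "line_at c i $ 1 = snd c i $ 1" "line_at c i $ 2 = snd c i $ 2"
  by (simp_all add: line_at_def)

text \<open>The action of the inverse matrix produces preimages, which is how configurations with prescribed generic
images are found below.\<close>
lemma act_matrix_inv:
  assumes A: "invertible A" and d: "proj_denom (matrix_inv A) (fst e i) \<noteq> 0"
  defines "c \<equiv> act (matrix_inv A) e"
  shows "proj_denom A (fst c i) \<noteq> 0" "fst (act A c) i = fst e i" "snd (act A c) i = snd e i"
proof -
  define d where "d = proj_denom (matrix_inv A) (fst e i)"
  have d0: "d \<noteq> 0"
    using assms by (simp add: d_def)
  have inv: "invertible (matrix_inv A)"
    using invertible_matrix_inv[OF A] invertible_def by blast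
  have inv_inv: "matrix_inv (matrix_inv A) = A"
    using invertible_matrix_inv[OF A] invertible_matrix_inv[OF inv]
    by (metis matrix_mul_assoc matrix_mul_lid matrix_mul_rid)
  have "A *v homog (fst c i) = (1 / d) *\<^sub>R homog (fst e i)"
    using homog_proj_map[of "matrix_inv A" "fst e i"] d0
    by (simp add: c_def act_def d_def matrix_vector_mult_scaleR matrix_vector_mul_assoc
        invertible_matrix_inv A)
  then have Ah: "(A *v homog (fst c i)) $ k = homog (fst e i) $ k / d" for k
    by simp
  then have dA: "proj_denom A (fst c i) = 1 / d"
    by (simp add: proj_denom_def homog_def)
  then show nz: "proj_denom A (fst c i) \<noteq> 0"
    using d0 by simp
  show "fst (act A c) i = fst e i"
    using d0 by (simp add: act_def proj_map_def dA Ah vec_eq_iff forall_2) (simp add: homog_def)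
  have 1: "line_at c i = d *\<^sub>R (line_at e i v* A)"
    using line_at_act[OF inv d] by (simp only: inv_inv c_def d_def)
  have 2: "line_at (act A c) i = (1 / d) *\<^sub>R (line_at c i v* matrix_inv A)"
    using line_at_act[OF A nz] by (simp only: dA)
  have "line_at (act A c) i = line_at e i"
    unfolding 2 1 scaleR_vector_matrix_assoc vector_matrix_mul_assoc invertible_matrix_inv(1)[OF A]
      vector_matrix_mul_rid scaleR_scaleR using d0 by simp
  then show "snd (act A c) i = snd e i"
    by (simp add: vec_eq_iff forall_2 forall_3)
qed

lemma det_lines_act:
  assumes "invertible A" "\<And>l. l \<in> {i, j, k} \<Longrightarrow> proj_denom A (fst c l) \<noteq> 0"
  shows "det (vector [line_at (act A c) i, line_at (act A c) j, line_at (act A c) k] :: real^3^3) =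
    proj_denom A (fst c i) * proj_denom A (fst c j) * proj_denom A (fst c k) / det A *
    det (vector [line_at c i, line_at c j, line_at c k] :: real^3^3)"
proof -
  let ?B = "matrix_inv A"
  have scale: "det (vector [x *\<^sub>R a, y *\<^sub>R b, z *\<^sub>R c] :: real^3^3) = x * y * z * det (vector [a, b, c] :: real^3^3)"
    for x y z a b c
    by (simp add: det_3 algebra_simps)
  have mult: "(vector [a v* B, b v* B, c v* B] :: real^3^3) = vector [a, b, c] ** B" for a b c and B :: "real^3^3"
    by (simp add: vec_eq_iff forall_3 vector_matrix_mult_def matrix_matrix_mult_def mult_ac)
  have "det A * det ?B = 1"
    by (metis assms(1) invertible_matrix_inv(1) det_mul det_I)
  then have "det ?B = 1 / det A"
    by (metis inverse_unique inverse_eq_divide)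
  then show ?thesis
    using assms by (simp add: line_at_act scale mult det_mul)
qed

section \<open>Values of rational functions\<close>
lemma has_valueE:
  assumes "has_value F c r"
  obtains a b where "F = Fract a b" "eval_mpoly b c \<noteq> 0" "r = eval_mpoly a c / eval_mpoly b c"
  using assms unfolding has_value_def by blast

text \<open>Evaluation is a ring homomorphism, so two fractions representing the same element agree wherever both
denominators are nonzero.\<close>
lemma has_value_unique:
  assumes "has_value F c r" "has_value F c s"
  shows "r = s"
proof -
  obtain a b where ab: "F = Fract a b" "eval_mpoly b c \<noteq> 0" "r = eval_mpoly a c / eval_mpoly b c"
    using assms(1) by (rule has_valueE)
  obtain a' b' where ab': "F = Fract a' b'" "eval_mpoly b' c \<noteq> 0" "s = eval_mpoly a' c / eval_mpoly b' c"
    using assms(2) by (rule has_valueE)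
  have "b \<noteq> 0" "b' \<noteq> 0"
    using ab(2) ab'(2) by auto
  then have "a * b' = a' * b"
    using ab(1) ab'(1) by (simp add: eq_fract)
  then have "eval_mpoly (a * b') c = eval_mpoly (a' * b) c"
    by simp
  then show ?thesis
    using ab(2,3) ab'(2,3) by (simp add: frac_eq_eq)
qed

lemma has_value_Fract: "eval_mpoly b c \<noteq> 0 \<Longrightarrow> has_value (Fract a b) c (eval_mpoly a c / eval_mpoly b c)"
  unfolding has_value_def by blast

lemma has_value_mult:
  assumes "has_value F c r" "has_value G c s"
  shows "has_value (F * G) c (r * s)"
proof -
  obtain a b where ab: "F = Fract a b" "eval_mpoly b c \<noteq> 0" "r = eval_mpoly a c / eval_mpoly b c"
    using assms(1) by (rule has_valueE)
  obtain a' b' where ab': "G = Fract a' b'" "eval_mpoly b' c \<noteq> 0" "s = eval_mpoly a' c / eval_mpoly b' c"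
    using assms(2) by (rule has_valueE)
  show ?thesis
    using has_value_Fract[of "b * b'" c "a * a'"] ab ab' by simp
qed

lemma has_value_inverse:
  assumes "has_value F c r" "r \<noteq> 0"
  shows "has_value (inverse F) c (inverse r)"
proof -
  obtain a b where ab: "F = Fract a b" "eval_mpoly b c \<noteq> 0" "r = eval_mpoly a c / eval_mpoly b c"
    using assms(1) by (rule has_valueE)
  then show ?thesis
    using has_value_Fract[of a c b] assms(2) by simp
qed

lemma has_value_1: "has_value 1 c 1"
  using has_value_Fract[of 1 c 1] by (simp add: One_fract_def)

lemma has_value_power: "has_value F c r \<Longrightarrow> has_value (F ^ k) c (r ^ k)"
  by (induction k) (auto intro: has_value_1 has_value_mult)

lemma has_value_prod:
  "(\<And>i. i \<in> I \<Longrightarrow> has_value (F i) c (r i)) \<Longrightarrow> has_value (\<Prod>i\<in>I. F i) c (\<Prod>i\<in>I. r i)"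
  by (induction I rule: infinite_finite_induct) (auto intro: has_value_1 has_value_mult)

lemma has_value_divide:
  "has_value F c r \<Longrightarrow> has_value G c s \<Longrightarrow> s \<noteq> 0 \<Longrightarrow> has_value (F / G) c (r / s)"
  unfolding divide_inverse by (intro has_value_mult has_value_inverse)

section \<open>Rational functions of the first points\<close>
definition agree_upto :: "nat \<Rightarrow> config \<Rightarrow> config \<Rightarrow> bool" where
  "agree_upto n c c' \<longleftrightarrow> (\<forall>i\<in>{1..n}. fst c i = fst c' i \<and> snd c i = snd c' i)"

text \<open>A semantic form of saying that only variables of the first $n$ points occur. Points of larger index matter
because their denominators may vanish, in which case their images are meaningless.\<close>
definition local_upto :: "nat \<Rightarrow> mpoly \<Rightarrow> bool" where
  "local_upto n f \<longleftrightarrow> (\<forall>c c'. agree_upto n c c' \<longrightarrow> eval_mpoly f c = eval_mpoly f c')"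

lemma local_uptoD: "local_upto n f \<Longrightarrow> agree_upto n c c' \<Longrightarrow> eval_mpoly f c = eval_mpoly f c'"
  unfolding local_upto_def by blast

lemma local_upto_0: "local_upto n 0"
  and local_upto_1: "local_upto n 1"
  and local_upto_const: "local_upto n (Poly_Mapping.single 0 a)"
  by (simp_all add: local_upto_def)

lemma local_upto_add: "local_upto n f \<Longrightarrow> local_upto n g \<Longrightarrow> local_upto n (f + g)"
  and local_upto_mult: "local_upto n f \<Longrightarrow> local_upto n g \<Longrightarrow> local_upto n (f * g)"
  and local_upto_uminus: "local_upto n f \<Longrightarrow> local_upto n (- f)"
  unfolding local_upto_def eval_mpoly_add eval_mpoly_mult eval_mpoly_uminus by metis+

lemmas local_upto_intros = local_upto_0 local_upto_1 local_upto_const local_upto_add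
  local_upto_mult local_upto_uminus

lemma local_upto_var:
  assumes "v \<in> (\<Union>i\<in>{1..n}. {Xc i, Yc i, Pc i, Qc i})"
  shows "local_upto n (Poly_Mapping.single (Poly_Mapping.single v 1) 1)"
  using assms by (auto simp: local_upto_def agree_upto_def)

definition local_fractions :: "nat \<Rightarrow> ratfun set" where
  "local_fractions n = {F. \<exists>a b. F = Fract a b \<and> b \<noteq> 0 \<and> local_upto n a \<and> local_upto n b}"

lemma local_fractionsI: "b \<noteq> 0 \<Longrightarrow> local_upto n a \<Longrightarrow> local_upto n b \<Longrightarrow> Fract a b \<in> local_fractions n"
  unfolding local_fractions_def by blast

lemma local_fractionsE:
  assumes "F \<in> local_fractions n"
  obtains a b where "F = Fract a b" "b \<noteq> 0" "local_upto n a" "local_upto n b"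
  using assms unfolding local_fractions_def by blast

lemma is_subfield_local_fractions: "is_subfield (local_fractions n)"
proof -
  have 0: "0 \<in> local_fractions n" and 1: "1 \<in> local_fractions n"
    unfolding Zero_fract_def One_fract_def by (auto intro!: local_fractionsI local_upto_intros)
  moreover have "x + y \<in> local_fractions n \<and> x * y \<in> local_fractions n"
    if "x \<in> local_fractions n" "y \<in> local_fractions n" for x y
    using that by (auto intro!: local_fractionsI local_upto_intros elim!: local_fractionsE)
  moreover have "- x \<in> local_fractions n \<and> inverse x \<in> local_fractions n"
    if "x \<in> local_fractions n" for x
    using that
  proof (rule local_fractionsE)
    fix a b assume ab: "x = Fract a b" "b \<noteq> 0" "local_upto n a" "local_upto n b"
    have "inverse x \<in> local_fractions n"
      using ab 0 by (cases "a = 0") (auto intro!: local_fractionsI local_upto_intros simp: fract_collapse)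
    then show ?thesis
      using ab by (auto intro!: local_fractionsI local_upto_intros)
  qed
  ultimately show ?thesis
    unfolding is_subfield_def by blast
qed

lemma J1_subset_local_fractions: "J1 n \<subseteq> local_fractions n"
proof -
  have "const_fun a \<in> local_fractions n" for a
    unfolding const_fun_def by (auto intro!: local_fractionsI local_upto_intros)
  moreover have "var_fun v \<in> local_fractions n" if "v \<in> (\<Union>i\<in>{1..n}. {Xc i, Yc i, Pc i, Qc i})" for v
    unfolding var_fun_def by (intro local_fractionsI local_upto_var[OF that] local_upto_1 one_neq_zero)
  ultimately show ?thesis
    unfolding J1_def by (intro hull_minimal is_subfield_local_fractions) auto
qed

lemma is_subfield_hull: "is_subfield (is_subfield hull S)"
  by (rule hull_in) (auto simp: is_subfield_def)

lemma is_subfield_J1: "is_subfield (J1 n)"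
  unfolding J1_def by (rule is_subfield_hull)

context
  fixes K :: "'a::field set"
  assumes K: "is_subfield K"
begin

lemma is_subfield_mult: "a \<in> K \<Longrightarrow> b \<in> K \<Longrightarrow> a * b \<in> K"
  and is_subfield_add: "a \<in> K \<Longrightarrow> b \<in> K \<Longrightarrow> a + b \<in> K"
  and is_subfield_uminus: "a \<in> K \<Longrightarrow> - a \<in> K"
  and is_subfield_inverse: "a \<in> K \<Longrightarrow> inverse a \<in> K"
  and is_subfield_0: "0 \<in> K"
  and is_subfield_1: "1 \<in> K"
  using K by (auto simp: is_subfield_def)

lemma is_subfield_diff: "a \<in> K \<Longrightarrow> b \<in> K \<Longrightarrow> a - b \<in> K"
  using is_subfield_add[of a "- b"] is_subfield_uminus by simp

lemma is_subfield_divide: "a \<in> K \<Longrightarrow> b \<in> K \<Longrightarrow> a / b \<in> K"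
  unfolding divide_inverse by (intro is_subfield_mult is_subfield_inverse)

lemma is_subfield_power: "a \<in> K \<Longrightarrow> a ^ k \<in> K"
  by (induction k) (auto intro: is_subfield_mult is_subfield_1)

lemma is_subfield_power_int: "a \<in> K \<Longrightarrow> a powi k \<in> K"
  by (simp add: power_int_def is_subfield_power is_subfield_inverse)

lemma is_subfield_prod: "(\<And>i. i \<in> I \<Longrightarrow> f i \<in> K) \<Longrightarrow> (\<Prod>i\<in>I. f i) \<in> K"
  by (induction I rule: infinite_finite_induct) (auto intro: is_subfield_mult is_subfield_1)

end

lemma agree_upto_act: "agree_upto n c c' \<Longrightarrow> agree_upto n (act A c) (act A c')"
  by (simp add: agree_upto_def act_def)

section \<open>Rational functions of one real parameter\<close>
text \<open>A single nonvanishing denominator is required on all of \<open>S\<close>, so such a function is continuous on \<open>S\<close> and,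
unless it is zero throughout, has finitely many zeros there.\<close>
definition rational_on :: "real set \<Rightarrow> (real \<Rightarrow> real) \<Rightarrow> bool" where
  "rational_on S h \<longleftrightarrow> (\<exists>P Q. \<forall>t\<in>S. poly Q t \<noteq> 0 \<and> h t = poly P t / poly Q t)"

lemma rational_on_const [intro]: "rational_on S (\<lambda>t. a)"
  unfolding rational_on_def by (intro exI[of _ "[:a:]"] exI[of _ 1]) auto

lemma rational_on_ident [intro]: "rational_on S (\<lambda>t. t)"
  unfolding rational_on_def by (intro exI[of _ "[:0, 1:]"] exI[of _ 1]) auto

lemma rational_on_add [intro]:
  assumes "rational_on S f" "rational_on S g"
  shows "rational_on S (\<lambda>t. f t + g t)"
proof -
  obtain P Q P' Q' where "\<And>t. t \<in> S \<Longrightarrow> poly Q t \<noteq> 0 \<and> f t = poly P t / poly Q t"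
      "\<And>t. t \<in> S \<Longrightarrow> poly Q' t \<noteq> 0 \<and> g t = poly P' t / poly Q' t"
    using assms unfolding rational_on_def by metis
  then show ?thesis
    unfolding rational_on_def
    by (intro exI[of _ "P * Q' + P' * Q"] exI[of _ "Q * Q'"]) (simp add: add_frac_eq)
qed

lemma rational_on_mult [intro]:
  assumes "rational_on S f" "rational_on S g"
  shows "rational_on S (\<lambda>t. f t * g t)"
proof -
  obtain P Q P' Q' where "\<And>t. t \<in> S \<Longrightarrow> poly Q t \<noteq> 0 \<and> f t = poly P t / poly Q t"
      "\<And>t. t \<in> S \<Longrightarrow> poly Q' t \<noteq> 0 \<and> g t = poly P' t / poly Q' t"
    using assms unfolding rational_on_def by metis
  then show ?thesis
    unfolding rational_on_def
    by (intro exI[of _ "P * P'"] exI[of _ "Q * Q'"]) simp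
qed

lemma rational_on_inverse:
  assumes "rational_on S f" "\<And>t. t \<in> S \<Longrightarrow> f t \<noteq> 0"
  shows "rational_on S (\<lambda>t. inverse (f t))"
proof -
  obtain P Q where "\<And>t. t \<in> S \<Longrightarrow> poly Q t \<noteq> 0 \<and> f t = poly P t / poly Q t"
    using assms(1) unfolding rational_on_def by metis
  then show ?thesis
    using assms(2) unfolding rational_on_def
    by (intro exI[of _ Q] exI[of _ P]) force
qed

lemma rational_on_uminus [intro]: "rational_on S f \<Longrightarrow> rational_on S (\<lambda>t. - f t)"
  using rational_on_mult[OF rational_on_const[of S "-1"]] by simp

lemma rational_on_diff [intro]: "rational_on S f \<Longrightarrow> rational_on S g \<Longrightarrow> rational_on S (\<lambda>t. f t - g t)"
  using rational_on_add[OF _ rational_on_uminus, of S f g] by simp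

lemma rational_on_divide:
  "rational_on S f \<Longrightarrow> rational_on S g \<Longrightarrow> (\<And>t. t \<in> S \<Longrightarrow> g t \<noteq> 0) \<Longrightarrow> rational_on S (\<lambda>t. f t / g t)"
  unfolding divide_inverse by (intro rational_on_mult rational_on_inverse)

lemma rational_on_power [intro]: "rational_on S f \<Longrightarrow> rational_on S (\<lambda>t. f t ^ k)"
  by (induction k) auto

lemma rational_on_sum: "(\<And>i. i \<in> I \<Longrightarrow> rational_on S (f i)) \<Longrightarrow> rational_on S (\<lambda>t. \<Sum>i\<in>I. f i t)"
  by (induction I rule: infinite_finite_induct) auto

lemma rational_on_prod: "(\<And>i. i \<in> I \<Longrightarrow> rational_on S (f i)) \<Longrightarrow> rational_on S (\<lambda>t. \<Prod>i\<in>I. f i t)"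
  by (induction I rule: infinite_finite_induct) auto

lemma rational_on_eval_mpoly:
  assumes "\<And>v. rational_on S (\<lambda>t. coord_value (\<gamma> t) v)"
  shows "rational_on S (\<lambda>t. eval_mpoly f (\<gamma> t))"
  unfolding eval_mpoly_def
  by (intro rational_on_sum rational_on_mult rational_on_const rational_on_prod rational_on_power assms)

lemma rational_on_cong: "(\<And>t. t \<in> S \<Longrightarrow> f t = g t) \<Longrightarrow> rational_on S f \<longleftrightarrow> rational_on S g"
  unfolding rational_on_def by (metis (no_types, lifting))

lemma rational_on_tendsto:
  assumes "rational_on S h" "open S" "t0 \<in> S"
  shows "(h \<longlongrightarrow> h t0) (at t0)"
proof -
  obtain P Q where PQ: "\<And>t. t \<in> S \<Longrightarrow> poly Q t \<noteq> 0 \<and> h t = poly P t / poly Q t"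
    using assms(1) unfolding rational_on_def by metis
  have "((\<lambda>t. poly P t / poly Q t) \<longlongrightarrow> h t0) (at t0)"
    using PQ[OF assms(3)] by (auto intro!: tendsto_eq_intros)
  moreover have "\<forall>\<^sub>F t in at t0. poly P t / poly Q t = h t"
    using eventually_at_in_open'[OF assms(2,3)] by eventually_elim (simp add: PQ)
  ultimately show ?thesis
    by (rule Lim_transform_eventually)
qed

lemma poly_eventually_nonzero:
  fixes P :: "real poly"
  assumes "P \<noteq> 0"
  shows "\<forall>\<^sub>F t in at t0. poly P t \<noteq> 0"
proof -
  let ?R = "{t. poly P t = 0} - {t0}"
  have "finite ?R"
    using poly_roots_finite[OF assms] by simp
  then have "open (- ?R)"
    by (intro open_Compl finite_imp_closed)
  then have "\<forall>\<^sub>F t in at t0. t \<in> - ?R - {t0}"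
    by (rule eventually_at_in_open) simp
  then show ?thesis
    by eventually_elim auto
qed

lemma rational_on_eventually_nonzero:
  assumes "rational_on S h" "open S" "t0 \<in> S" "t1 \<in> S" "h t1 \<noteq> 0"
  shows "\<forall>\<^sub>F t in at t0. h t \<noteq> 0"
proof -
  obtain P Q where PQ: "\<And>t. t \<in> S \<Longrightarrow> poly Q t \<noteq> 0 \<and> h t = poly P t / poly Q t"
    using assms(1) unfolding rational_on_def by metis
  then have "P \<noteq> 0"
    using assms(4,5) by force
  show ?thesis
    using poly_eventually_nonzero[OF \<open>P \<noteq> 0\<close>, of t0] eventually_at_in_open'[OF assms(2,3)]
    by eventually_elim (simp add: PQ)
qed

section \<open>Configurations in general position\<close>
text \<open>Only the first $n$ points move. The others, whose images need not depend continuously on the point, stay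
fixed together with their images.\<close>
definition segment_upto :: "nat \<Rightarrow> config \<Rightarrow> config \<Rightarrow> real \<Rightarrow> config" where
  "segment_upto n c e t =
     (\<lambda>i. if i \<in> {1..n} then fst c i + t *\<^sub>R (fst e i - fst c i) else fst c i,
      \<lambda>i. if i \<in> {1..n} then snd c i + t *\<^sub>R (snd e i - snd c i) else snd c i)"

lemma segment_upto_0: "segment_upto n c e 0 = c"
  by (simp add: segment_upto_def prod_eq_iff fun_eq_iff)

lemma agree_upto_segment_upto_1: "agree_upto n (segment_upto n c e 1) e"
  by (simp add: segment_upto_def agree_upto_def)

lemma segment_upto_inside:
  assumes "i \<in> {1..n}"
  shows "fst (segment_upto n c e t) i = fst c i + t *\<^sub>R (fst e i - fst c i)"
    "snd (segment_upto n c e t) i = snd c i + t *\<^sub>R (snd e i - snd c i)"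
  using assms by (simp_all add: segment_upto_def)

lemma segment_upto_outside:
  assumes "i \<notin> {1..n}"
  shows "fst (segment_upto n c e t) i = fst c i" "snd (segment_upto n c e t) i = snd c i"
  using assms by (auto simp: segment_upto_def)

lemma rational_on_segment_upto:
  "rational_on S (\<lambda>t. fst (segment_upto n c e t) i $ k)"
  "rational_on S (\<lambda>t. snd (segment_upto n c e t) i $ k)"
proof -
  have affine: "rational_on S (\<lambda>t. a + t * b)" for a b
    by (intro rational_on_add rational_on_mult rational_on_const rational_on_ident)
  show "rational_on S (\<lambda>t. fst (segment_upto n c e t) i $ k)"
    using affine by (cases "i \<in> {1..n}") (simp_all add: segment_upto_inside segment_upto_outside rational_on_const
        vector_add_component vector_scaleR_component)
  show "rational_on S (\<lambda>t. snd (segment_upto n c e t) i $ k)"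
    using affine by (cases "i \<in> {1..n}") (simp_all add: segment_upto_inside segment_upto_outside rational_on_const
        vector_add_component vector_scaleR_component)
qed

lemma rational_on_coord_value_segment_upto: "rational_on S (\<lambda>t. coord_value (segment_upto n c e t) v)"
  by (cases v) (simp_all add: rational_on_segment_upto)

lemma rational_on_proj_denom_segment_upto:
  "rational_on S (\<lambda>t. proj_denom A (fst (segment_upto n c e t) i))"
  unfolding proj_denom_eq
  by (intro rational_on_add rational_on_mult rational_on_const rational_on_segment_upto)

lemma act_nth:
  assumes "invertible A" "proj_denom A (fst c i) \<noteq> 0"
  shows "fst (act A c) i $ 1 = (A *v homog (fst c i)) $ 1 / proj_denom A (fst c i)"
    "fst (act A c) i $ 2 = (A *v homog (fst c i)) $ 2 / proj_denom A (fst c i)"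
    "snd (act A c) i $ 1 = proj_denom A (fst c i) * (line_at c i v* matrix_inv A) $ 1"
    "snd (act A c) i $ 2 = proj_denom A (fst c i) * (line_at c i v* matrix_inv A) $ 2"
proof -
  show "fst (act A c) i $ 1 = (A *v homog (fst c i)) $ 1 / proj_denom A (fst c i)"
    "fst (act A c) i $ 2 = (A *v homog (fst c i)) $ 2 / proj_denom A (fst c i)"
    by (simp_all add: act_def proj_map_def)
  have "line_at (act A c) i $ k = proj_denom A (fst c i) * (line_at c i v* matrix_inv A) $ k" for k
    using line_at_act[OF assms] by simp
  from this[of 1] this[of 2]
  show "snd (act A c) i $ 1 = proj_denom A (fst c i) * (line_at c i v* matrix_inv A) $ 1"
    "snd (act A c) i $ 2 = proj_denom A (fst c i) * (line_at c i v* matrix_inv A) $ 2"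
    by simp_all
qed

text \<open>The image of a gradient is read off from the image of its line, which avoids inverting Jacobian matrices.\<close>
lemma rational_on_coord_value_act:
  assumes A: "invertible A"
    and rational: "\<And>k. rational_on S (\<lambda>t. fst (\<gamma> t) i $ k)" "\<And>k. rational_on S (\<lambda>t. snd (\<gamma> t) i $ k)"
    and nonzero: "\<And>t. t \<in> S \<Longrightarrow> proj_denom A (fst (\<gamma> t) i) \<noteq> 0"
    and v: "v \<in> {Xc i, Yc i, Pc i, Qc i}"
  shows "rational_on S (\<lambda>t. coord_value (act A (\<gamma> t)) v)"
proof -
  let ?d = "\<lambda>t. proj_denom A (fst (\<gamma> t) i)"
  have d: "rational_on S ?d"
    unfolding proj_denom_eq by (intro rational_on_add rational_on_mult rational_on_const rational)
  have points: "rational_on S (\<lambda>t. (A *v homog (fst (\<gamma> t) i)) $ k / ?d t)" for k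
    by (rule rational_on_divide[OF _ d nonzero])
      (auto simp only: homog_image_eq intro!: rational_on_add rational_on_mult rational_on_const rational)
  have line: "rational_on S (\<lambda>t. line_at (\<gamma> t) i $ k)" for k
  proof -
    consider "k = 1" | "k = 2" | "k = 3"
      using exhaust_3 by blast
    then show ?thesis
      by cases (simp_all add: line_at_def rational rational_on_diff rational_on_mult rational_on_uminus)
  qed
  have "rational_on S (\<lambda>t. (line_at (\<gamma> t) i v* matrix_inv A) $ k)" for k
    unfolding vector_matrix_mult_def vec_lambda_beta
    by (intro rational_on_sum rational_on_mult rational_on_const line)
  then have lines: "rational_on S (\<lambda>t. ?d t * (line_at (\<gamma> t) i v* matrix_inv A) $ k)" for k
    by (rule rational_on_mult[OF d])
  have "rational_on S (\<lambda>t. fst (act A (\<gamma> t)) i $ 1)" "rational_on S (\<lambda>t. fst (act A (\<gamma> t)) i $ 2)"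
    "rational_on S (\<lambda>t. snd (act A (\<gamma> t)) i $ 1)" "rational_on S (\<lambda>t. snd (act A (\<gamma> t)) i $ 2)"
    using points[of 1] points[of 2] lines[of 1] lines[of 2]
    by (simp_all only: act_nth[OF A nonzero] cong: rational_on_cong)
  then show ?thesis
    using v by auto
qed

definition segment_domain :: "nat \<Rightarrow> real^3^3 \<Rightarrow> config \<Rightarrow> config \<Rightarrow> real set" where
  "segment_domain n A c e = {t. \<forall>i\<in>{1..n}. proj_denom A (fst (segment_upto n c e t) i) \<noteq> 0}"

lemma open_segment_domain: "open (segment_domain n A c e)"
proof -
  have "isCont (\<lambda>t. proj_denom A (fst (segment_upto n c e t) i)) t" for i t
    unfolding isCont_def
    using rational_on_tendsto[OF rational_on_proj_denom_segment_upto open_UNIV UNIV_I] .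
  then have "continuous_on UNIV (\<lambda>t. proj_denom A (fst (segment_upto n c e t) i))" for i
    by (simp add: continuous_at_imp_continuous_on)
  then have "open {t. proj_denom A (fst (segment_upto n c e t) i) \<noteq> 0}" for i
    by (intro open_Collect_neq continuous_on_const)
  moreover have "segment_domain n A c e =
      (\<Inter>i\<in>{1..n}. {t. proj_denom A (fst (segment_upto n c e t) i) \<noteq> 0})"
    by (auto simp: segment_domain_def)
  ultimately show ?thesis
    by auto
qed

lemma rational_on_coord_value_act_segment_upto:
  assumes A: "invertible A"
  shows "rational_on (segment_domain n A c e) (\<lambda>t. coord_value (act A (segment_upto n c e t)) v)"
proof -
  obtain i where v: "v \<in> {Xc i, Yc i, Pc i, Qc i}"
    by (cases v) auto
  show ?thesis
  proof (cases "i \<in> {1..n}")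
    case True
    then show ?thesis
      using rational_on_coord_value_act[OF A rational_on_segment_upto _ v, of "segment_domain n A c e" n c e]
      by (auto simp: segment_domain_def)
  next
    case False
    then have "coord_value (act A (segment_upto n c e t)) v = coord_value (act A c) v" for t
      using v by (auto simp: act_def segment_upto_outside)
    then show ?thesis
      by (simp add: rational_on_const)
  qed
qed

lemma proj_denom_nonzero_ex:
  assumes "invertible A"
  shows "\<exists>z. proj_denom A z \<noteq> 0"
proof (rule ccontr)
  assume "\<not> ?thesis"
  then have 0: "proj_denom A z = 0" for z
    by blast
  have "A$3$3 = 0" "A$3$1 = 0" "A$3$2 = 0"
    using 0[of "vector [0, 0]"] 0[of "vector [1, 0]"] 0[of "vector [0, 1]"] by (simp_all add: proj_denom_eq)
  then have "det A = 0"
    by (simp add: det_3)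
  then show False
    using assms by (simp add: invertible_det_nz)
qed

lemma invertible_matrix_inv_invertible: "invertible A \<Longrightarrow> invertible (matrix_inv A)"
  using invertible_matrix_inv[of A] invertible_def by blast

text \<open>Pull back by the inverse matrix a configuration \<open>e\<close> where \<open>h\<close> and the denominators of the inverse map do
not vanish. To get both at once, move from a nonzero of \<open>h\<close> towards a configuration whose points all have
nonzero denominator.\<close>
lemma image_nonvanishing_ex:
  assumes h: "h \<noteq> 0" "local_upto n h" and A: "invertible A"
  shows "\<exists>c. (\<forall>i\<in>{1..n}. proj_denom A (fst c i) \<noteq> 0) \<and> eval_mpoly h (act A c) \<noteq> 0"
proof -
  let ?B = "matrix_inv A"
  obtain e0 where e0: "eval_mpoly h e0 \<noteq> 0"
    using eval_mpoly_nonzero_ex[OF h(1)] by blast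
  obtain z where z: "proj_denom ?B z \<noteq> 0"
    using proj_denom_nonzero_ex[OF invertible_matrix_inv_invertible[OF A]] by blast
  define e1 :: config where "e1 = (\<lambda>_. z, \<lambda>_. 0)"
  let ?seg = "segment_upto n e0 e1"
  have "\<forall>\<^sub>F t in at 0. eval_mpoly h (?seg t) \<noteq> 0"
    by (rule rational_on_eventually_nonzero[of UNIV _ 0 0])
      (use e0 in \<open>simp_all add: rational_on_eval_mpoly rational_on_coord_value_segment_upto segment_upto_0\<close>)
  moreover have "\<forall>\<^sub>F t in at 0. proj_denom ?B (fst (?seg t) i) \<noteq> 0" if "i \<in> {1..n}" for i
    by (rule rational_on_eventually_nonzero[OF rational_on_proj_denom_segment_upto, of UNIV 0 1])
      (use that z in \<open>simp_all add: e1_def segment_upto_inside\<close>)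
  then have "\<forall>\<^sub>F t in at 0. \<forall>i\<in>{1..n}. proj_denom ?B (fst (?seg t) i) \<noteq> 0"
    by (intro eventually_ball_finite) auto
  ultimately have "\<forall>\<^sub>F t in at 0. eval_mpoly h (?seg t) \<noteq> 0 \<and> (\<forall>i\<in>{1..n}. proj_denom ?B (fst (?seg t) i) \<noteq> 0)"
    by (rule eventually_conj)
  then obtain t where t: "eval_mpoly h (?seg t) \<noteq> 0" "\<forall>i\<in>{1..n}. proj_denom ?B (fst (?seg t) i) \<noteq> 0"
    using eventually_happens'[OF trivial_limit_at] by blast
  define e where "e = ?seg t"
  have "agree_upto n (act A (act ?B e)) e"
    using act_matrix_inv[OF A, of e] t(2) by (simp add: agree_upto_def e_def)
  then have "eval_mpoly h (act A (act ?B e)) \<noteq> 0"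
    using local_uptoD[OF h(2)] t(1) by (simp add: e_def)
  moreover have "\<forall>i\<in>{1..n}. proj_denom A (fst (act ?B e) i) \<noteq> 0"
    using act_matrix_inv(1)[OF A, of e] t(2) by (simp add: e_def)
  ultimately show ?thesis
    by blast
qed

lemma eventually_nonvanishing_on_segment:
  assumes h: "local_upto n h" "eval_mpoly h e \<noteq> 0"
  shows "\<forall>\<^sub>F t in at 0. eval_mpoly h (segment_upto n c e t) \<noteq> 0"
  by (rule rational_on_eventually_nonzero[of UNIV _ 0 1])
    (use h(2) local_uptoD[OF h(1) agree_upto_segment_upto_1] in
      \<open>simp_all add: rational_on_eval_mpoly rational_on_coord_value_segment_upto\<close>)

lemma eventually_image_nonvanishing_on_segment:
  assumes A: "invertible A" and t: "0 \<in> segment_domain n A c e" "t1 \<in> segment_domain n A c e"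
    and h: "eval_mpoly h (act A (segment_upto n c e t1)) \<noteq> 0"
  shows "\<forall>\<^sub>F t in at 0. eval_mpoly h (act A (segment_upto n c e t)) \<noteq> 0"
  by (rule rational_on_eventually_nonzero[OF rational_on_eval_mpoly open_segment_domain t])
    (use h A rational_on_coord_value_act_segment_upto in auto)

lemma zero_in_segment_domain:
  "0 \<in> segment_domain n A c e \<longleftrightarrow> (\<forall>i\<in>{1..n}. proj_denom A (fst c i) \<noteq> 0)"
  by (simp add: segment_domain_def segment_upto_0)

lemma one_in_segment_domain:
  "1 \<in> segment_domain n A c e \<longleftrightarrow> (\<forall>i\<in>{1..n}. proj_denom A (fst e i) \<noteq> 0)"
  by (simp add: segment_domain_def segment_upto_def)

text \<open>A nonzero rational function on a segment vanishes only finitely often, so a single good configuration makes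
almost all configurations on a segment through it good. This is used twice: first to find an endpoint \<open>e\<close>
good for \<open>h\<close> and for the image simultaneously, then on the segment from \<open>c\<close> to \<open>e\<close>.\<close>
lemma generic_segment_ex:
  assumes h: "h \<noteq> 0" "local_upto n h" and A: "invertible A"
    and c: "\<forall>i\<in>{1..n}. proj_denom A (fst c i) \<noteq> 0"
  shows "\<exists>e. \<forall>\<^sub>F t in at 0. t \<in> segment_domain n A c e \<and> eval_mpoly h (segment_upto n c e t) \<noteq> 0 \<and>
           eval_mpoly h (act A (segment_upto n c e t)) \<noteq> 0"
proof -
  obtain e0 where e0: "eval_mpoly h e0 \<noteq> 0"
    using eval_mpoly_nonzero_ex[OF h(1)] by blast
  obtain c1 where c1: "\<forall>i\<in>{1..n}. proj_denom A (fst c1 i) \<noteq> 0" "eval_mpoly h (act A c1) \<noteq> 0"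
    using image_nonvanishing_ex[OF h A] by blast
  let ?seg = "segment_upto n c1 e0"
  have 0: "0 \<in> segment_domain n A c1 e0"
    using c1 by (simp add: zero_in_segment_domain)
  have "\<forall>\<^sub>F t in at 0. eval_mpoly h (act A (?seg t)) \<noteq> 0"
    by (rule eventually_image_nonvanishing_on_segment[OF A 0 0]) (simp add: segment_upto_0 c1)
  with eventually_nonvanishing_on_segment[OF h(2) e0, of c1] eventually_at_in_open'[OF open_segment_domain 0]
  have "\<forall>\<^sub>F t in at 0. t \<in> segment_domain n A c1 e0 \<and> eval_mpoly h (?seg t) \<noteq> 0 \<and> eval_mpoly h (act A (?seg t)) \<noteq> 0"
    by eventually_elim simp
  then obtain t where t: "t \<in> segment_domain n A c1 e0" "eval_mpoly h (?seg t) \<noteq> 0" "eval_mpoly h (act A (?seg t)) \<noteq> 0"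
    using eventually_happens'[OF trivial_limit_at] by blast
  define e where "e = ?seg t"
  have 0: "0 \<in> segment_domain n A c e" and 1: "1 \<in> segment_domain n A c e"
    unfolding zero_in_segment_domain one_in_segment_domain
    using c t(1) by (simp_all add: e_def segment_domain_def)
  have "eval_mpoly h (act A (segment_upto n c e 1)) \<noteq> 0"
    using t(3) local_uptoD[OF h(2) agree_upto_act[OF agree_upto_segment_upto_1]] by (simp add: e_def)
  note eventually_image_nonvanishing_on_segment[OF A 0 1 this]
  moreover have "\<forall>\<^sub>F t in at 0. eval_mpoly h (segment_upto n c e t) \<noteq> 0"
    using t(2) by (intro eventually_nonvanishing_on_segment h) (simp add: e_def)
  moreover note eventually_at_in_open'[OF open_segment_domain 0]
  ultimately have "\<forall>\<^sub>F t in at 0. t \<in> segment_domain n A c e \<and> eval_mpoly h (segment_upto n c e t) \<noteq> 0 \<and>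
      eval_mpoly h (act A (segment_upto n c e t)) \<noteq> 0"
    by eventually_elim simp
  then show ?thesis ..
qed

section \<open>Relative invariants whose weight is a third of an integer\<close>
text \<open>Whether or not $k / 3$ is in lowest terms, the power is an integer power of the real cube root. In this form
exponents add without any condition on the sign of \<open>x\<close>.\<close>
lemma rat_power_third:
  assumes "x \<noteq> 0"
  shows "rat_power x (of_int k / 3) = root 3 x powi k" "rat_power_defined x (of_int k / 3)"
proof -
  have quotient: "(\<exists>j. k = 3 * j \<and> quotient_of (of_int k / 3) = (j, 1)) \<or> quotient_of (of_int k / 3) = (k, 3)"
  proof (cases "3 dvd k")
    case True
    then obtain j where "k = 3 * j" ..
    then have "(of_int k / 3 :: rat) = of_int j"
      by simp
    then show ?thesis
      using \<open>k = 3 * j\<close> by simp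
  next
    case False
    obtain p q where pq: "quotient_of (of_int k / 3) = (p, q)"
      by (cases "quotient_of (of_int k / 3)")
    have q: "q > 0" and coprime: "coprime p q"
      using quotient_of_denom_pos[OF pq] quotient_of_coprime[OF pq] .
    have "(of_int k / 3 :: rat) = of_int p / of_int q"
      using quotient_of_div[OF pq] .
    then have "(of_int (k * q) :: rat) = of_int (3 * p)"
      using q by (simp add: field_simps)
    then have eq: "k * q = 3 * p"
      by (simp only: of_int_eq_iff)
    have "q dvd 3 * p"
      using eq by (metis dvd_triv_right)
    then have "q dvd 3"
      using coprime by (simp add: coprime_commute coprime_dvd_mult_left_iff)
    moreover have "3 dvd k * q"
      using eq by simp
    then have "3 dvd q"
      using False by (auto simp: prime_dvd_mult_iff)
    ultimately have "q = 3"
      using q by (simp add: zdvd_antisym_nonneg)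
    then show ?thesis
      using eq pq by simp
  qed
  then show "rat_power_defined x (of_int k / 3)"
    using assms by (auto simp: rat_power_defined_def)
  from quotient show "rat_power x (of_int k / 3) = root 3 x powi k"
  proof (elim disjE exE conjE)
    fix j assume j: "k = 3 * j" "quotient_of (of_int k / 3) = (j, 1)"
    have "root 3 x powi (3 * j) = (root 3 x ^ 3) powi j"
      by (simp add: power_int_mult)
    then show "rat_power x (of_int k / 3) = root 3 x powi k"
      using j by (simp add: rat_power_def odd_real_root_pow)
  qed (simp add: rat_power_def)
qed

lemma total_jacobian_nonzero:
  "invertible A \<Longrightarrow> \<forall>i\<in>{1..n}. proj_denom A (fst c i) \<noteq> 0 \<Longrightarrow> total_jacobian n A c \<noteq> 0"
  by (simp add: total_jacobian_def invertible_det_nz)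

lemma relative_invariant_thirdD:
  assumes "relative_invariant n (of_int k / 3) F" "invertible A"
    "\<forall>i\<in>{1..n}. proj_denom A (fst c i) \<noteq> 0" "has_value F c r" "has_value F (act A c) s"
  shows "s = root 3 (total_jacobian n A c) powi k * r"
  using assms rat_power_third[OF total_jacobian_nonzero[OF assms(2,3)], where k = k]
  unfolding relative_invariant_def by metis

text \<open>It suffices to check the transformation law where an auxiliary polynomial \<open>h\<close> vanishes neither at the
configuration nor at its image: the fractions witnessing the two values are continuous along a generic
segment, and so is the cube root of the total Jacobian.\<close>
lemma relative_invariant_thirdI:
  assumes F: "F \<in> J1 n" and h: "h \<noteq> 0" "local_upto n h"
    and generic: "\<And>A c. invertible A \<Longrightarrow> \<forall>i\<in>{1..n}. proj_denom A (fst c i) \<noteq> 0 \<Longrightarrow>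
      eval_mpoly h c \<noteq> 0 \<Longrightarrow> eval_mpoly h (act A c) \<noteq> 0 \<Longrightarrow>
      \<exists>r. has_value F c r \<and> has_value F (act A c) (root 3 (total_jacobian n A c) powi k * r)"
  shows "relative_invariant n (of_int k / 3) F"
proof -
  have "s = rat_power (total_jacobian n A c) (of_int k / 3) * r"
    if A: "invertible A" and c: "\<forall>i\<in>{1..n}. proj_denom A (fst c i) \<noteq> 0"
      and r: "has_value F c r" and s: "has_value F (act A c) s" for A c r s
  proof -
    obtain a b where ab: "F = Fract a b" "eval_mpoly b c \<noteq> 0" "r = eval_mpoly a c / eval_mpoly b c"
      using r by (rule has_valueE)
    obtain a' b' where ab': "F = Fract a' b'" "eval_mpoly b' (act A c) \<noteq> 0"
        "s = eval_mpoly a' (act A c) / eval_mpoly b' (act A c)"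
      using s by (rule has_valueE)
    obtain e where e: "\<forall>\<^sub>F t in at 0. t \<in> segment_domain n A c e \<and>
        eval_mpoly h (segment_upto n c e t) \<noteq> 0 \<and> eval_mpoly h (act A (segment_upto n c e t)) \<noteq> 0"
      using generic_segment_ex[OF h A c] by blast
    define \<gamma> where "\<gamma> = segment_upto n c e"
    let ?\<rho> = "\<lambda>c. root 3 (total_jacobian n A c) powi k"
    have \<gamma>0: "\<gamma> 0 = c"
      by (simp add: \<gamma>_def segment_upto_0)
    have 0: "0 \<in> segment_domain n A c e"
      using c by (simp add: zero_in_segment_domain)
    have lim: "((\<lambda>t. eval_mpoly f (\<gamma> t)) \<longlongrightarrow> eval_mpoly f c) (at 0)" for f
      using rational_on_tendsto[OF rational_on_eval_mpoly[OF rational_on_coord_value_segment_upto] open_UNIV UNIV_I, of f n c e 0]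
      unfolding \<gamma>_def[symmetric] \<gamma>0 .
    have lim': "((\<lambda>t. eval_mpoly f (act A (\<gamma> t))) \<longlongrightarrow> eval_mpoly f (act A c)) (at 0)" for f
      using rational_on_tendsto[OF rational_on_eval_mpoly[OF rational_on_coord_value_act_segment_upto[OF A]] open_segment_domain 0, of f]
      unfolding \<gamma>_def[symmetric] \<gamma>0 .
    have lim_d: "((\<lambda>t. proj_denom A (fst (\<gamma> t) i)) \<longlongrightarrow> proj_denom A (fst c i)) (at 0)" for i
      using rational_on_tendsto[OF rational_on_proj_denom_segment_upto open_UNIV UNIV_I, of A n c e i 0]
      unfolding \<gamma>_def[symmetric] \<gamma>0 .
    have lim_J: "((\<lambda>t. total_jacobian n A (\<gamma> t)) \<longlongrightarrow> total_jacobian n A c) (at 0)"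
      unfolding total_jacobian_def
      by (intro tendsto_prod tendsto_divide tendsto_const tendsto_power lim_d) (use c in auto)
    have J0: "total_jacobian n A c \<noteq> 0"
      by (rule total_jacobian_nonzero[OF A c])
    have "\<forall>\<^sub>F t in at 0. eval_mpoly a' (act A (\<gamma> t)) / eval_mpoly b' (act A (\<gamma> t)) =
        ?\<rho> (\<gamma> t) * (eval_mpoly a (\<gamma> t) / eval_mpoly b (\<gamma> t))"
      using e tendsto_imp_eventually_ne[OF lim ab(2)] tendsto_imp_eventually_ne[OF lim' ab'(2)]
    proof eventually_elim
      case (elim t)
      have "has_value F (\<gamma> t) (eval_mpoly a (\<gamma> t) / eval_mpoly b (\<gamma> t))"
        using elim has_value_Fract ab(1) by simp
      moreover have "has_value F (act A (\<gamma> t)) (eval_mpoly a' (act A (\<gamma> t)) / eval_mpoly b' (act A (\<gamma> t)))"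
        using elim has_value_Fract ab'(1) by simp
      moreover obtain x where "has_value F (\<gamma> t) x" "has_value F (act A (\<gamma> t)) (?\<rho> (\<gamma> t) * x)"
        using generic[of A "\<gamma> t"] A elim by (auto simp: \<gamma>_def segment_domain_def)
      ultimately show ?case
        using has_value_unique by metis
    qed
    moreover have "((\<lambda>t. eval_mpoly a' (act A (\<gamma> t)) / eval_mpoly b' (act A (\<gamma> t))) \<longlongrightarrow> s) (at 0)"
      unfolding ab'(3) by (intro tendsto_divide lim' ab'(2))
    ultimately have "((\<lambda>t. ?\<rho> (\<gamma> t) * (eval_mpoly a (\<gamma> t) / eval_mpoly b (\<gamma> t))) \<longlongrightarrow> s) (at 0)"
      by (rule Lim_transform_eventually[rotated])
    moreover have "((\<lambda>t. ?\<rho> (\<gamma> t) * (eval_mpoly a (\<gamma> t) / eval_mpoly b (\<gamma> t))) \<longlongrightarrow> ?\<rho> c * r) (at 0)"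
      unfolding ab(3) using J0
      by (intro tendsto_mult tendsto_divide tendsto_power_int tendsto_real_root lim lim_J ab(2)) simp
    ultimately have "s = ?\<rho> c * r"
      using tendsto_unique[OF trivial_limit_at] by blast
    then show ?thesis
      by (simp only: rat_power_third(1)[OF J0])
  qed
  then show ?thesis
    using F unfolding relative_invariant_def by blast
qed

lemma J1_fractE:
  assumes "F \<in> J1 n"
  obtains a b where "F = Fract a b" "b \<noteq> 0" "local_upto n a" "local_upto n b"
  using assms J1_subset_local_fractions local_fractionsE by blast

lemma relative_invariant_third_mult:
  assumes F: "relative_invariant n (of_int k / 3) F" and G: "relative_invariant n (of_int l / 3) G"
  shows "relative_invariant n (of_int (k + l) / 3) (F * G)"
proof -
  have J1: "F \<in> J1 n" "G \<in> J1 n"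
    using F G by (simp_all add: relative_invariant_def)
  obtain a b where ab: "F = Fract a b" "b \<noteq> 0" "local_upto n b"
    using J1(1) by (rule J1_fractE)
  obtain a' b' where ab': "G = Fract a' b'" "b' \<noteq> 0" "local_upto n b'"
    using J1(2) by (rule J1_fractE)
  show ?thesis
  proof (rule relative_invariant_thirdI[where h = "b * b'"])
    show "F * G \<in> J1 n"
      by (intro is_subfield_mult is_subfield_J1 J1)
    show "b * b' \<noteq> 0" "local_upto n (b * b')"
      using ab ab' by (auto intro: local_upto_mult)
    fix A c
    assume A: "invertible A" and c: "\<forall>i\<in>{1..n}. proj_denom A (fst c i) \<noteq> 0"
      and nz: "eval_mpoly (b * b') c \<noteq> 0" "eval_mpoly (b * b') (act A c) \<noteq> 0"
    let ?\<rho> = "root 3 (total_jacobian n A c)"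
    have nz': "eval_mpoly b c \<noteq> 0" "eval_mpoly b' c \<noteq> 0" "eval_mpoly b (act A c) \<noteq> 0" "eval_mpoly b' (act A c) \<noteq> 0"
      using nz by auto
    obtain r s where rs: "has_value F c r" "has_value G c s"
      using has_value_Fract[of b c a] has_value_Fract[of b' c a'] nz' ab(1) ab'(1) by blast
    obtain r' s' where rs': "has_value F (act A c) r'" "has_value G (act A c) s'"
      using has_value_Fract[of b "act A c" a] has_value_Fract[of b' "act A c" a'] nz' ab(1) ab'(1) by blast
    have eq: "r' = ?\<rho> powi k * r" "s' = ?\<rho> powi l * s"
      using relative_invariant_thirdD[OF F A c rs(1) rs'(1)] relative_invariant_thirdD[OF G A c rs(2) rs'(2)] .
    have "?\<rho> \<noteq> 0"
      using total_jacobian_nonzero[OF A c] by simp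
    then have "r' * s' = ?\<rho> powi (k + l) * (r * s)"
      by (simp add: eq power_int_add)
    then show "\<exists>x. has_value (F * G) c x \<and> has_value (F * G) (act A c) (?\<rho> powi (k + l) * x)"
      using has_value_mult[OF rs] has_value_mult[OF rs'] by metis
  qed
qed

lemma relative_invariant_third_inverse:
  assumes F: "relative_invariant n (of_int k / 3) F" and "F \<noteq> 0"
  shows "relative_invariant n (of_int (- k) / 3) (inverse F)"
proof -
  have J1: "F \<in> J1 n"
    using F by (simp add: relative_invariant_def)
  obtain a b where ab: "F = Fract a b" "b \<noteq> 0" "local_upto n a" "local_upto n b"
    using J1 by (rule J1_fractE)
  have "a \<noteq> 0"
    using ab \<open>F \<noteq> 0\<close> by (auto simp: fract_collapse)
  show ?thesis
  proof (rule relative_invariant_thirdI[where h = "a * b"])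
    show "inverse F \<in> J1 n"
      by (intro is_subfield_inverse is_subfield_J1 J1)
    show "a * b \<noteq> 0" "local_upto n (a * b)"
      using ab \<open>a \<noteq> 0\<close> by (auto intro: local_upto_mult)
    fix A c
    assume A: "invertible A" and c: "\<forall>i\<in>{1..n}. proj_denom A (fst c i) \<noteq> 0"
      and nz: "eval_mpoly (a * b) c \<noteq> 0" "eval_mpoly (a * b) (act A c) \<noteq> 0"
    let ?\<rho> = "root 3 (total_jacobian n A c)"
    obtain r where r: "has_value F c r" "r \<noteq> 0"
      using has_value_Fract[of b c a] nz(1) ab(1) by fastforce
    obtain r' where r': "has_value F (act A c) r'" "r' \<noteq> 0"
      using has_value_Fract[of b "act A c" a] nz(2) ab(1) by fastforce
    have "r' = ?\<rho> powi k * r"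
      using relative_invariant_thirdD[OF F A c r(1) r'(1)] .
    then have "inverse r' = ?\<rho> powi (- k) * inverse r"
      by (simp add: power_int_minus)
    then show "\<exists>x. has_value (inverse F) c x \<and> has_value (inverse F) (act A c) (?\<rho> powi (- k) * x)"
      using has_value_inverse[OF r] has_value_inverse[OF r'] by metis
  qed
qed

lemma relative_invariant_1: "relative_invariant n 0 1"
proof -
  have "relative_invariant n (of_int 0 / 3) 1"
    by (rule relative_invariant_thirdI[where h = 1])
      (auto intro: has_value_1 local_upto_1 is_subfield_1 is_subfield_J1)
  then show ?thesis
    by simp
qed

lemma relative_invariant_third_power:
  assumes "relative_invariant n (of_int k / 3) F"
  shows "relative_invariant n (of_int (int j * k) / 3) (F ^ j)"
proof (induction j)
  case 0
  then show ?case
    by (simp add: relative_invariant_1)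
next
  case (Suc j)
  then show ?case
    using relative_invariant_third_mult[OF assms Suc] by (simp add: algebra_simps)
qed

lemma relative_invariant_third_power_int:
  assumes "relative_invariant n (of_int k / 3) F" "F \<noteq> 0"
  shows "relative_invariant n (of_int (j * k) / 3) (F powi j)"
proof (cases "j \<ge> 0")
  case True
  then show ?thesis
    using relative_invariant_third_power[OF assms(1), of "nat j"] by (simp add: power_int_def)
next
  case False
  then show ?thesis
    using relative_invariant_third_power[OF relative_invariant_third_inverse[OF assms], of "nat (- j)"]
    by (simp add: power_int_def)
qed

section \<open>The relative invariant \<open>z_elem\<close>\<close>
definition delta_at :: "config \<Rightarrow> nat \<Rightarrow> nat \<Rightarrow> nat \<Rightarrow> real" where
  "delta_at c i j k = det (vector [line_at c i, line_at c j, line_at c k] :: real^3^3)"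

definition coord_poly :: "coord \<Rightarrow> mpoly" where
  "coord_poly v = Poly_Mapping.single (Poly_Mapping.single v 1) 1"

lemma eval_coord_poly [simp]: "eval_mpoly (coord_poly v) c = coord_value c v"
  by (simp add: coord_poly_def)

lemma var_fun_eq: "var_fun v = Fract (coord_poly v) 1"
  by (simp add: var_fun_def coord_poly_def)

definition line_poly :: "nat \<Rightarrow> mpoly^3" where
  "line_poly i = vector [coord_poly (Pc i), coord_poly (Qc i),
     - coord_poly (Pc i) * coord_poly (Xc i) - coord_poly (Qc i) * coord_poly (Yc i)]"

definition Delta_poly :: "nat \<Rightarrow> nat \<Rightarrow> nat \<Rightarrow> mpoly" where
  "Delta_poly i j k = det (vector [line_poly i, line_poly j, line_poly k] :: mpoly^3^3)"

lemma Delta_eq: "Delta i j k = Fract (Delta_poly i j k) 1"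
proof -
  have "ell i $ m = Fract (line_poly i $ m) 1" for i m
  proof -
    consider "m = 1" | "m = 2" | "m = 3"
      using exhaust_3 by blast
    then show ?thesis
      by cases (simp_all add: ell_def line_poly_def var_fun_eq)
  qed
  then show ?thesis
    by (simp add: Delta_def Delta_poly_def det_3)
qed

lemma eval_Delta_poly: "eval_mpoly (Delta_poly i j k) c = delta_at c i j k"
proof -
  have "eval_mpoly (line_poly i $ m) c = line_at c i $ m" for i m
  proof -
    consider "m = 1" | "m = 2" | "m = 3"
      using exhaust_3 by blast
    then show ?thesis
      by cases (simp_all add: line_at_def line_poly_def)
  qed
  then show ?thesis
    by (simp only: delta_at_def Delta_poly_def det_3 vector_3 eval_mpoly_add eval_mpoly_diff eval_mpoly_mult)
qed

lemma has_value_Delta: "has_value (Delta i j k) c (delta_at c i j k)"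
  using has_value_Fract[of 1 c "Delta_poly i j k"] by (simp add: Delta_eq eval_Delta_poly)

lemma local_upto_Delta_poly:
  assumes "i \<in> {1..n}" "j \<in> {1..n}" "k \<in> {1..n}"
  shows "local_upto n (Delta_poly i j k)"
proof -
  have "line_at c l = line_at c' l" if "agree_upto n c c'" "l \<in> {1..n}" for c c' l
    using that by (simp add: agree_upto_def line_at_def)
  then have "delta_at c i j k = delta_at c' i j k" if "agree_upto n c c'" for c c'
    using that assms unfolding delta_at_def by metis
  then show ?thesis
    unfolding local_upto_def eval_Delta_poly by blast
qed

lemma Delta_in_J1:
  assumes "i \<in> {1..n}" "j \<in> {1..n}" "k \<in> {1..n}"
  shows "Delta i j k \<in> J1 n"
proof -
  have var: "var_fun v \<in> J1 n" if "v \<in> {Xc l, Yc l, Pc l, Qc l}" "l \<in> {1..n}" for v l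
    unfolding J1_def by (rule hull_inc) (use that in blast)
  have ell: "ell l $ m \<in> J1 n" if l: "l \<in> {1..n}" for l m
  proof -
    have v: "var_fun (Xc l) \<in> J1 n" "var_fun (Yc l) \<in> J1 n" "var_fun (Pc l) \<in> J1 n" "var_fun (Qc l) \<in> J1 n"
      using var[OF _ l] by simp_all
    consider "m = 1" | "m = 2" | "m = 3"
      using exhaust_3 by blast
    then show ?thesis
      by cases (simp_all add: ell_def v is_subfield_diff is_subfield_mult is_subfield_uminus is_subfield_J1)
  qed
  show ?thesis
    unfolding Delta_def det_3 vector_3
    by (intro is_subfield_diff is_subfield_add is_subfield_mult is_subfield_J1 ell assms)
qed

lemma has_value_nonzero: "has_value F c r \<Longrightarrow> r \<noteq> 0 \<Longrightarrow> F \<noteq> 0"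
  using has_value_unique[of F c r 0] has_value_Fract[of 1 c 0] by (auto simp: Zero_fract_def)

text \<open>Choose the gradients and points so that the three lines are $(1, 0, 0)$, $(0, 1, 0)$ and $(1, 0, 1)$.\<close>
lemma Delta_nonzero:
  assumes "i \<noteq> j" "i \<noteq> k" "j \<noteq> k"
  shows "Delta i j k \<noteq> 0"
proof -
  obtain c where c: "\<And>v. coord_value c v = (if v \<in> {Pc i, Qc j, Pc k} then 1 else if v = Xc k then - 1 else 0)"
    using config_with_coords[of "\<lambda>v. if v \<in> {Pc i, Qc j, Pc k} then 1 else if v = Xc k then - 1 else 0"] by metis
  have "delta_at c i j k = 1"
    using c[of "Pc i"] c[of "Pc j"] c[of "Pc k"] c[of "Qc i"] c[of "Qc j"] c[of "Qc k"] c[of "Xc i"] c[of "Xc j"] c[of "Xc k"] assms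
    by (simp add: delta_at_def det_3 line_at_def)
  then show ?thesis
    using has_value_nonzero[OF has_value_Delta] by (metis one_neq_zero)
qed

definition z_value :: "nat \<Rightarrow> (nat \<Rightarrow> nat \<Rightarrow> nat \<Rightarrow> real) \<Rightarrow> real" where
  "z_value n \<delta> =
     (if n = 3 then \<delta> 1 2 3
      else if n = 4 then \<delta> 1 2 3 * \<delta> 1 2 4 * \<delta> 1 3 4 * \<delta> 2 3 4
      else if gcd n 3 = 1 then
        (\<Prod>i=5..n. \<delta> 1 2 i) ^ 3 * (\<delta> 1 3 4 * \<delta> 2 3 4) ^ (n - 3) / (\<delta> 1 2 3 * \<delta> 1 2 4) ^ (2 * n - 9)
      else
        (\<Prod>i=5..n. \<delta> 1 2 i) * (\<delta> 1 3 4 * \<delta> 2 3 4) ^ (n div 3 - 1) / (\<delta> 1 2 3 * \<delta> 1 2 4) ^ (2 * n div 3 - 3))"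

lemma has_value_z_elem:
  assumes "n \<ge> 5 \<Longrightarrow> delta_at c 1 2 3 \<noteq> 0" "n \<ge> 5 \<Longrightarrow> delta_at c 1 2 4 \<noteq> 0" "n \<ge> 3"
  shows "has_value (z_elem n) c (z_value n (delta_at c))"
proof -
  consider "n = 3" | "n = 4" | "n \<ge> 5"
    using assms(3) by linarith
  then show ?thesis
    unfolding z_elem_def z_value_def
    by cases (use assms in \<open>auto intro!: has_value_divide has_value_mult has_value_power has_value_prod has_value_Delta\<close>)
qed

lemma gcd_3: "gcd n 3 = (if 3 dvd n then 3 else 1)" for n :: nat
proof (cases "3 dvd n")
  case False
  then have "coprime 3 n"
    by (intro prime_imp_coprime) simp_all
  then show ?thesis
    using False by (simp add: gcd.commute coprime_iff_gcd_eq_1)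
qed (simp add: gcd_nat.absorb2)

text \<open>In \<open>z_elem\<close> each index from $1$ to $n$ occurs $3 / \gcd(n, 3)$ times, counted with the exponents. For
$n \ge 5$ the indices $1, 2$ enter symmetrically, and so do $3, 4$, so the bookkeeping reduces to the
exponents of $u = \rho_1 \rho_2$, of $v = \rho_3 \rho_4$ and of the product $R$ of the remaining factors.\<close>
lemma z_value_rescale:
  fixes \<rho> :: "nat \<Rightarrow> real"
  assumes n: "n \<ge> 3" and \<rho>: "\<And>i. i \<in> {1..n} \<Longrightarrow> \<rho> i \<noteq> 0"
    and \<delta>': "\<And>i j k. i \<in> {1..n} \<Longrightarrow> j \<in> {1..n} \<Longrightarrow> k \<in> {1..n} \<Longrightarrow> \<delta>' i j k = \<delta> i j k / (\<rho> i * \<rho> j * \<rho> k)"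
  shows "z_value n \<delta>' = z_value n \<delta> / (\<Prod>i=1..n. \<rho> i) ^ (3 div gcd n 3)"
proof -
  consider "n = 3" | "n = 4" | "n \<ge> 5"
    using n by linarith
  then show ?thesis
  proof cases
    case 1
    moreover have "{1..3} = {1, 2, 3::nat}"
      by auto
    ultimately show ?thesis
      by (simp add: z_value_def \<delta>')
  next
    case 2
    moreover have "{1..4} = {1, 2, 3, 4::nat}"
      by auto
    moreover have "gcd 4 3 = (1::nat)"
      by (simp add: gcd_3)
    ultimately show ?thesis
      by (simp add: z_value_def \<delta>' power3_eq_cube mult_ac)
  next
    case 3
    define u v R where "u = \<rho> 1 * \<rho> 2" and "v = \<rho> 3 * \<rho> 4" and "R = (\<Prod>i=5..n. \<rho> i)"
    define D a b where "D = (\<Prod>i=5..n. \<delta> 1 2 i)" and "a = \<delta> 1 3 4 * \<delta> 2 3 4" and "b = \<delta> 1 2 3 * \<delta> 1 2 4"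
    have nz: "u \<noteq> 0" "v \<noteq> 0" "R \<noteq> 0"
      using \<rho> 3 by (auto simp: u_def v_def R_def)
    have "{1..n} = {1, 2, 3, 4} \<union> {5..n}"
      using 3 by auto
    then have total: "(\<Prod>i=1..n. \<rho> i) = u * v * R"
      by (simp add: prod.union_disjoint u_def v_def R_def mult_ac)
    have "(\<Prod>i=5..n. \<delta>' 1 2 i) = (\<Prod>i=5..n. \<delta> 1 2 i / (u * \<rho> i))"
      using 3 by (intro prod.cong) (auto simp: \<delta>' u_def)
    also have "\<dots> = D / (u ^ (n - 4) * R)"
      by (simp add: prod_dividef prod.distrib D_def R_def)
    finally have D': "(\<Prod>i=5..n. \<delta>' 1 2 i) = D / (u ^ (n - 4) * R)" .
    have a': "\<delta>' 1 3 4 * \<delta>' 2 3 4 = a / (u * v ^ 2)" and b': "\<delta>' 1 2 3 * \<delta>' 1 2 4 = b / (u ^ 2 * v)"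
      using 3 by (simp_all add: \<delta>' a_def b_def u_def v_def power2_eq_square mult_ac)
    have quotient: "(D / X) ^ l * (a / Y) ^ p / (b / Z) ^ q = D ^ l * a ^ p / b ^ q / W"
      if "X ^ l * Y ^ p = Z ^ q * W" "Z \<noteq> 0" for X Y Z W l p q
    proof -
      have "(D / X) ^ l * (a / Y) ^ p / (b / Z) ^ q = (D ^ l * a ^ p * Z ^ q) / ((X ^ l * Y ^ p) * b ^ q)"
        by (simp add: power_divide)
      also have "\<dots> = D ^ l * a ^ p / b ^ q / W"
        unfolding that(1) using that(2) by simp
      finally show ?thesis .
    qed
    show ?thesis
    proof (cases "3 dvd n")
      case False
      \<comment> \<open>A parameter free of truncated subtraction makes the exponents linear.\<close>
      define m where "m = n - 5"
      have m: "n - 4 = m + 1" "n - 3 = m + 2" "2 * n - 9 = 2 * m + 1"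
        using 3 by (simp_all add: m_def)
      have "(u ^ (m + 1) * R) ^ 3 * (u * v ^ 2) ^ (m + 2) = (u ^ 2 * v) ^ (2 * m + 1) * (u * v * R) ^ 3"
        by (simp add: power_mult_distrib power_add mult_2 mult_2_right power2_eq_square power3_eq_cube mult_ac)
      then show ?thesis
        using quotient[of "u ^ (m + 1) * R" 3 "u * v ^ 2" "m + 2" "u ^ 2 * v" "2 * m + 1" "(u * v * R) ^ 3"] 3 False nz
        unfolding z_value_def D' a' b' total m D_def[symmetric] a_def[symmetric] b_def[symmetric]
        by (simp add: gcd_3)
    next
      case True
      then obtain k where k: "n = 3 * k" ..
      have "k \<ge> 2"
        using 3 k by linarith
      then obtain j where j: "k = j + 2"
        using le_Suc_ex by (metis add.commute)
      have exponents: "n - 4 = j + j + j + 2" "n div 3 - 1 = j + 1" "2 * n div 3 - 3 = 2 * j + 1"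
        by (simp_all add: k j)
      have "(u ^ (j + j + j + 2) * R) ^ 1 * (u * v ^ 2) ^ (j + 1) = (u ^ 2 * v) ^ (2 * j + 1) * (u * v * R)"
        by (simp add: power_mult_distrib power_add mult_2 mult_2_right power2_eq_square mult_ac)
      then show ?thesis
        using quotient[of "u ^ (j + j + j + 2) * R" 1 "u * v ^ 2" "j + 1" "u ^ 2 * v" "2 * j + 1" "u * v * R"] 3 True nz
        unfolding z_value_def D' a' b' total exponents D_def[symmetric] a_def[symmetric] b_def[symmetric]
        by (simp add: gcd_3)
    qed
  qed
qed

lemma z_elem_in_J1:
  assumes "n \<ge> 3"
  shows "z_elem n \<in> J1 n"
proof -
  consider "n = 3" | "n = 4" | "n \<ge> 5"
    using assms by linarith
  then show ?thesis
    unfolding z_elem_def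
    by cases (auto intro!: is_subfield_divide is_subfield_mult is_subfield_power is_subfield_prod is_subfield_J1 Delta_in_J1)
qed

lemma z_elem_nonzero:
  assumes "n \<ge> 3"
  shows "z_elem n \<noteq> 0"
  unfolding z_elem_def by (auto simp: Delta_nonzero)

lemma delta_at_act:
  assumes "invertible A" "\<forall>i\<in>{1..n}. proj_denom A (fst c i) \<noteq> 0" "i \<in> {1..n}" "j \<in> {1..n}" "k \<in> {1..n}"
  defines "\<rho> \<equiv> \<lambda>i. root 3 (det A) / proj_denom A (fst c i)"
  shows "delta_at (act A c) i j k = delta_at c i j k / (\<rho> i * \<rho> j * \<rho> k)"
proof -
  have "root 3 (det A) * root 3 (det A) * root 3 (det A) = det A"
    by (metis odd_numeral odd_real_root_pow power3_eq_cube)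
  then have "\<rho> i * \<rho> j * \<rho> k = det A / (proj_denom A (fst c i) * proj_denom A (fst c j) * proj_denom A (fst c k))"
    by (simp add: \<rho>_def)
  moreover have "delta_at (act A c) i j k = proj_denom A (fst c i) * proj_denom A (fst c j) *
      proj_denom A (fst c k) / det A * delta_at c i j k"
    unfolding delta_at_def by (rule det_lines_act) (use assms in auto)
  ultimately show ?thesis
    by simp
qed

lemma root_total_jacobian:
  "root 3 (total_jacobian n A c) = (\<Prod>i=1..n. root 3 (det A) / proj_denom A (fst c i))"
proof -
  have "(\<Prod>i=1..n. root 3 (det A) / proj_denom A (fst c i)) ^ 3 = total_jacobian n A c"
    by (simp add: total_jacobian_def prod_power_distrib power_divide odd_real_root_pow)
  then show ?thesis
    by (metis odd_numeral odd_real_root_power_cancel)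
qed

lemma relative_invariant_z_elem:
  assumes n: "n \<ge> 3"
  shows "relative_invariant n (of_int (- int (3 div gcd n 3)) / 3) (z_elem n)"
proof (rule relative_invariant_thirdI[where h = "if n \<ge> 5 then Delta_poly 1 2 3 * Delta_poly 1 2 4 else 1"])
  let ?h = "if n \<ge> 5 then Delta_poly 1 2 3 * Delta_poly 1 2 4 else 1"
  show "z_elem n \<in> J1 n"
    by (rule z_elem_in_J1[OF n])
  have "Delta_poly 1 2 k \<noteq> 0" if "k \<in> {3, 4}" for k
    using Delta_nonzero[of 1 2 k] that by (auto simp: Delta_eq fract_collapse)
  then show "?h \<noteq> 0"
    by simp
  show "local_upto n ?h"
    by (simp add: local_upto_1 local_upto_mult local_upto_Delta_poly)
  fix A c
  assume A: "invertible A" and c: "\<forall>i\<in>{1..n}. proj_denom A (fst c i) \<noteq> 0"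
    and h: "eval_mpoly ?h c \<noteq> 0" "eval_mpoly ?h (act A c) \<noteq> 0"
  have "has_value (z_elem n) c (z_value n (delta_at c))"
    "has_value (z_elem n) (act A c) (z_value n (delta_at (act A c)))"
    using h n by (auto intro!: has_value_z_elem simp: eval_Delta_poly)
  moreover have "z_value n (delta_at (act A c)) =
      z_value n (delta_at c) / root 3 (total_jacobian n A c) ^ (3 div gcd n 3)"
    unfolding root_total_jacobian
    using A c by (intro z_value_rescale n delta_at_act) (auto simp: invertible_det_nz)
  ultimately show "\<exists>r. has_value (z_elem n) c r \<and>
      has_value (z_elem n) (act A c) (root 3 (total_jacobian n A c) powi (- int (3 div gcd n 3)) * r)"
    by (intro exI[of _ "z_value n (delta_at c)"]) (simp add: power_int_minus field_simps)
qed

section \<open>Restriction on the weights\<close>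
text \<open>The homology with axis $x = 0$ and centre $(1, 0)$: the centre is an eigenvector for $t$, the axis is fixed
pointwise, and $t = 1$ is the identity. A single family suffices because its total Jacobian
$t^n / \prod_i (1 + (t - 1) x_i)^3$ has both an order at $t = 0$ that sees $n$ and simple roots of the linear
factors that see the exponent $3$.\<close>
definition homology :: "real \<Rightarrow> real^3^3" where
  "homology t = vector [vector [t, 0, 0], vector [0, 1, 0], vector [t - 1, 0, 1]]"

lemma det_homology: "det (homology t) = t"
  by (simp add: det_3 homology_def)

lemma proj_denom_homology: "proj_denom (homology t) z = 1 + (t - 1) * z$1"
  by (simp add: proj_denom_eq homology_def)

lemma act_homology:
  assumes t: "t \<noteq> 0" and d: "proj_denom (homology t) (fst c i) \<noteq> 0"
  defines "d \<equiv> proj_denom (homology t) (fst c i)"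
  shows "fst (act (homology t) c) i $ 1 = t * fst c i $ 1 / d"
    "fst (act (homology t) c) i $ 2 = fst c i $ 2 / d"
    "snd (act (homology t) c) i $ 1 = d * (snd c i $ 1 - (t - 1) * line_at c i $ 3) / t"
    "snd (act (homology t) c) i $ 2 = d * snd c i $ 2"
proof -
  show "fst (act (homology t) c) i $ 1 = t * fst c i $ 1 / d" "fst (act (homology t) c) i $ 2 = fst c i $ 2 / d"
    by (simp_all add: act_def proj_map_def homog_image_eq d_def homology_def)
  have inv: "invertible (homology t)"
    using t by (simp add: invertible_det_nz det_homology)
  define l where "l = line_at (act (homology t) c) i"
  have "l v* homology t = d *\<^sub>R line_at c i"
    unfolding l_def line_at_act[OF inv d] d_def[symmetric]
    by (simp add: scaleR_vector_matrix_assoc vector_matrix_mul_assoc invertible_matrix_inv[OF inv])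
  then have nth: "(l v* homology t) $ m = d * line_at c i $ m" for m
    by simp
  have l: "l$1 * t + l$3 * (t - 1) = d * snd c i $ 1" "l$2 = d * snd c i $ 2" "l$3 = d * line_at c i $ 3"
    using nth[of 1] nth[of 2] nth[of 3]
    by (simp_all add: vector_matrix_mult_def sum_3 homology_def mult.commute)
  have "l$1 * t = d * (snd c i $ 1 - (t - 1) * line_at c i $ 3)"
    using l(1)[unfolded l(3)] by (simp add: algebra_simps)
  then show "snd (act (homology t) c) i $ 1 = d * (snd c i $ 1 - (t - 1) * line_at c i $ 3) / t"
    "snd (act (homology t) c) i $ 2 = d * snd c i $ 2"
    using t l(2) by (simp_all add: l_def field_simps)
qed

text \<open>The image of \<open>c\<close> for the first $n$ points only; the denominators of the infinitely many other points cannot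
be kept away from zero near $t = 1$.\<close>
definition homology_curve :: "nat \<Rightarrow> config \<Rightarrow> real \<Rightarrow> config" where
  "homology_curve n c t =
     (\<lambda>i. if i \<in> {1..n} then fst (act (homology t) c) i else fst c i,
      \<lambda>i. if i \<in> {1..n} then snd (act (homology t) c) i else snd c i)"

definition homology_domain :: "nat \<Rightarrow> config \<Rightarrow> real set" where
  "homology_domain n c = {t. 0 < t \<and> (\<forall>i\<in>{1..n}. 0 < proj_denom (homology t) (fst c i))}"

lemma agree_upto_homology_curve: "agree_upto n (act (homology t) c) (homology_curve n c t)"
  by (simp add: agree_upto_def homology_curve_def)

lemma agree_upto_homology_curve_1: "agree_upto n (homology_curve n c 1) c"
  using act_homology[of 1 c]
  by (simp add: agree_upto_def homology_curve_def proj_denom_homology vec_eq_iff forall_2)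

lemma rational_on_homology_curve:
  "rational_on (homology_domain n c) (\<lambda>t. coord_value (homology_curve n c t) v)"
proof -
  let ?S = "homology_domain n c"
  obtain i where v: "v \<in> {Xc i, Yc i, Pc i, Qc i}"
    by (cases v) auto
  show ?thesis
  proof (cases "i \<in> {1..n}")
    case True
    let ?d = "\<lambda>t. proj_denom (homology t) (fst c i)"
    have nz: "t \<noteq> 0" "?d t \<noteq> 0" if "t \<in> ?S" for t
      using that True by (force simp: homology_domain_def)+
    have d: "rational_on ?S ?d"
      unfolding proj_denom_homology
      by (intro rational_on_add rational_on_mult rational_on_diff rational_on_const rational_on_ident)
    have "rational_on ?S (\<lambda>t. t * fst c i $ 1 / ?d t)" "rational_on ?S (\<lambda>t. fst c i $ 2 / ?d t)"
      "rational_on ?S (\<lambda>t. ?d t * (snd c i $ 1 - (t - 1) * line_at c i $ 3) / t)"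
      "rational_on ?S (\<lambda>t. ?d t * snd c i $ 2)"
      by (intro rational_on_divide rational_on_mult rational_on_diff rational_on_const rational_on_ident d nz; assumption)+
    then have "rational_on ?S (\<lambda>t. fst (act (homology t) c) i $ 1)" "rational_on ?S (\<lambda>t. fst (act (homology t) c) i $ 2)"
      "rational_on ?S (\<lambda>t. snd (act (homology t) c) i $ 1)" "rational_on ?S (\<lambda>t. snd (act (homology t) c) i $ 2)"
      by (simp_all only: act_homology[OF nz] cong: rational_on_cong)
    then show ?thesis
      using v True by (auto simp: homology_curve_def)
  next
    case False
    then have "coord_value (homology_curve n c t) v = coord_value c v" for t
      using v by (auto simp: homology_curve_def)
    then show ?thesis
      by (simp add: rational_on_const)
  qed
qed

lemma open_homology_domain: "open (homology_domain n c)"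
proof -
  have "homology_domain n c = {0<..} \<inter> (\<Inter>i\<in>{1..n}. {t. 0 < 1 + (t - 1) * fst c i $ 1})"
    by (auto simp: homology_domain_def proj_denom_homology)
  moreover have "open {t. 0 < 1 + (t - 1) * fst c i $ 1}" for i
    by (intro open_Collect_less continuous_intros)
  ultimately show ?thesis
    by (auto intro!: open_Int open_INT)
qed

lemma one_in_homology_domain: "1 \<in> homology_domain n c"
  by (simp add: homology_domain_def proj_denom_homology)

lemma order_power: "P \<noteq> 0 \<Longrightarrow> order s (P ^ k) = k * order s P" for P :: "real poly"
proof (induction k)
  case 0
  then show ?case
    by (simp add: order_0I)
qed (simp add: order_mult)

lemma order_prod:
  fixes P :: "'a \<Rightarrow> real poly"
  assumes "finite I" "\<And>i. i \<in> I \<Longrightarrow> P i \<noteq> 0"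
  shows "order s (\<Prod>i\<in>I. P i) = (\<Sum>i\<in>I. order s (P i))"
  using assms by (induction rule: finite_induct) (auto simp: order_mult order_0I)

text \<open>$G / H$ is a constant times a $v$-th power in the field of rational functions, so its orders are multiples
of $v$.\<close>
lemma power_factor_order_dvd:
  fixes X Y G H :: "real poly"
  assumes "X \<noteq> 0" "Y \<noteq> 0" "G \<noteq> 0" "H \<noteq> 0" "a \<noteq> 0" and eq: "X ^ v * G = smult a (Y ^ v * H)"
  shows "int v dvd int (order s G) - int (order s H)"
proof -
  have "order s (X ^ v * G) = order s (Y ^ v * H)"
    unfolding eq using \<open>a \<noteq> 0\<close> by (rule order_smult)
  then have "v * order s X + order s G = v * order s Y + order s H"
    using assms(1-4) by (simp add: order_mult order_power)
  then have "int v * int (order s X) + int (order s G) = int v * int (order s Y) + int (order s H)"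
    by (metis of_nat_add of_nat_mult)
  then have "int (order s G) - int (order s H) = int v * (int (order s Y) - int (order s X))"
    by (simp add: algebra_simps)
  then show ?thesis
    by simp
qed

lemma order_affine_factor:
  fixes x s :: real
  assumes "x \<noteq> 0"
  shows "order s [:1 - x, x:] = (if s = 1 - 1 / x then 1 else 0)"
proof (cases "s = 1 - 1 / x")
  case True
  then have eq: "[:1 - x, x:] = smult x ([:- s, 1:] ^ 1)"
    using assms by (simp add: field_simps)
  have "order s [:1 - x, x:] = order s ([:- s, 1:] ^ 1)"
    unfolding eq by (rule order_smult[OF assms])
  then show ?thesis
    using True by (simp only: order_power_n_n if_True refl)
next
  case False
  have "poly [:1 - x, x:] s \<noteq> 0"
  proof
    assume "poly [:1 - x, x:] s = 0"
    then have "s = 1 - 1 / x"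
      using assms by (simp add: field_simps)
    with False show False ..
  qed
  then show ?thesis
    using False by (simp add: order_0I)
qed

lemma rat_power_pow_denominator:
  assumes "quotient_of w = (u, v)" "x > 0"
  shows "rat_power x w ^ nat v = x powi u"
proof -
  have v: "nat v > 0"
    using quotient_of_denom_pos[OF assms(1)] by simp
  have "rat_power x w ^ nat v = (root (nat v) x ^ nat v) powi u"
    unfolding rat_power_def assms(1) fst_conv snd_conv
    by (metis mult.commute power_int_mult power_int_of_nat)
  also have "\<dots> = x powi u"
    using v assms(2) by (simp add: real_root_pow_pos)
  finally show ?thesis .
qed

text \<open>The conditions on the abscissae separate the zeros used in the weight argument: $x_i \neq 0$ makes
$1 + (t - 1) x_i$ nonconstant with root $1 - 1 / x_i$, $x_i \neq 1$ keeps this root away from $t = 0$, and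
$x_i \neq x_1$ makes the root of the first factor simple.\<close>
lemma generic_point_ex:
  assumes "f \<noteq> 0"
  shows "\<exists>c. eval_mpoly f c \<noteq> 0 \<and> (\<forall>i\<in>{1..n}. fst c i $ 1 \<noteq> 0 \<and> fst c i $ 1 \<noteq> 1) \<and>
           (\<forall>i\<in>{2..n}. fst c i $ 1 \<noteq> fst c 1 $ 1)"
proof -
  let ?X = "\<lambda>i. coord_poly (Xc i)"
  \<comment> \<open>Distinct values, all at least $2$, keep every factor of \<open>?g\<close> below except \<open>f\<close> from vanishing.\<close>
  obtain c where c: "\<And>v. coord_value c v = real (coord_index v + 2)"
    using config_with_coords[of "\<lambda>v. real (coord_index v + 2)"] by metis
  have "eval_mpoly (?X i) c \<noteq> 0" "eval_mpoly (?X i - 1) c \<noteq> 0" for i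
    by (simp_all only: eval_coord_poly c eval_mpoly_diff eval_mpoly_1)
  moreover have "eval_mpoly (?X i - ?X 1) c \<noteq> 0" if "i \<in> {2..n}" for i
    using that by (simp only: eval_coord_poly c eval_mpoly_diff) simp
  ultimately have nz: "?X i \<noteq> 0" "?X i - 1 \<noteq> 0" "i \<in> {2..n} \<Longrightarrow> ?X i - ?X 1 \<noteq> 0" for i
    using eval_mpoly_0 by metis+
  let ?g = "f * (\<Prod>i\<in>{1..n}. ?X i * (?X i - 1)) * (\<Prod>i\<in>{2..n}. ?X i - ?X 1)"
  have "?g \<noteq> 0"
    using assms nz by (simp only: mult_eq_0_iff prod_zero_iff finite_atLeastAtMost) blast
  then obtain c where "eval_mpoly ?g c \<noteq> 0"
    using eval_mpoly_nonzero_ex by blast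
  then show ?thesis
    by (intro exI[of _ c]) (simp add: eval_mpoly_prod)
qed

text \<open>For $t$ near $1$ the total Jacobian is positive, so the transformation law may be raised to the $v$-th power
and becomes the identity $(X / Y)^v = r^v (t^n / E^3)^u$ with polynomials $X, Y, E$ in $t$. Comparing orders
at $t = 0$ gives $v \mid n u$, and at the root $1 - 1 / x_1$ of $E$ it gives $v \mid 3 u$.\<close>
lemma relative_invariant_weight:
  assumes F: "relative_invariant n w F" "F \<noteq> 0" and n: "n \<ge> 1"
  shows "\<exists>k::int. w = of_int k / of_nat (gcd n 3)"
proof -
  obtain u v where uv: "quotient_of w = (u, v)"
    by (cases "quotient_of w")
  have v: "v > 0" and coprime: "coprime u v" and w: "w = of_int u / of_int v"
    using quotient_of_denom_pos[OF uv] quotient_of_coprime[OF uv] quotient_of_div[OF uv] .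
  have "F \<in> J1 n"
    using F(1) by (simp add: relative_invariant_def)
  then obtain a b where ab: "F = Fract a b" "b \<noteq> 0" "local_upto n a" "local_upto n b"
    by (rule J1_fractE)
  have "a \<noteq> 0"
    using ab F(2) by (auto simp: fract_collapse)
  then have "a * b \<noteq> 0"
    using ab by simp
  then obtain c where c: "eval_mpoly (a * b) c \<noteq> 0" "\<forall>i\<in>{1..n}. fst c i $ 1 \<noteq> 0 \<and> fst c i $ 1 \<noteq> 1"
      "\<forall>i\<in>{2..n}. fst c i $ 1 \<noteq> fst c 1 $ 1"
    using generic_point_ex[of "a * b" n] by blast
  define x where "x i = fst c i $ 1" for i
  define S where "S = homology_domain n c"
  define \<gamma> where "\<gamma> = homology_curve n c"
  define r where "r = eval_mpoly a c / eval_mpoly b c"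
  have r: "has_value F c r" "r \<noteq> 0"
    using c(1) has_value_Fract[of b c a] ab(1) by (simp_all add: r_def)
  obtain P Q where PQ: "\<And>t. t \<in> S \<Longrightarrow> poly Q t \<noteq> 0 \<and> eval_mpoly a (\<gamma> t) = poly P t / poly Q t"
    using rational_on_eval_mpoly[OF rational_on_homology_curve] unfolding rational_on_def S_def \<gamma>_def by meson
  obtain P' Q' where PQ': "\<And>t. t \<in> S \<Longrightarrow> poly Q' t \<noteq> 0 \<and> eval_mpoly b (\<gamma> t) = poly P' t / poly Q' t"
    using rational_on_eval_mpoly[OF rational_on_homology_curve] unfolding rational_on_def S_def \<gamma>_def by meson
  have 1: "1 \<in> S"
    by (simp add: S_def one_in_homology_domain)
  have "eval_mpoly a (\<gamma> 1) \<noteq> 0" "eval_mpoly b (\<gamma> 1) \<noteq> 0"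
    using c(1) local_uptoD[OF ab(3) agree_upto_homology_curve_1] local_uptoD[OF ab(4) agree_upto_homology_curve_1]
    by (simp_all add: \<gamma>_def)
  then have nz: "P \<noteq> 0" "Q \<noteq> 0" "P' \<noteq> 0" "Q' \<noteq> 0"
    using PQ[OF 1] PQ'[OF 1] by auto
  define X Y where "X = P * Q'" and "Y = Q * P'"
  have XY: "X \<noteq> 0" "Y \<noteq> 0"
    using nz by (simp_all add: X_def Y_def)
  define E where "E = (\<Prod>i=1..n. [:1 - x i, x i:])"
  define T :: "real poly" where "T = [:0, 1:]"
  have ET: "E \<noteq> 0" "T \<noteq> 0"
    using c(2) by (auto simp: E_def T_def x_def)
  have poly_E: "poly E t = (\<Prod>i=1..n. proj_denom (homology t) (fst c i))" for t
    by (simp add: E_def poly_prod proj_denom_homology x_def algebra_simps)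
  have identity: "(poly X t / poly Y t) ^ nat v = (t ^ n / poly E t ^ 3) powi u * r ^ nat v" "t > 0" "poly E t > 0"
    if t: "t \<in> S" "poly Y t \<noteq> 0" for t
  proof -
    have pos: "t > 0" "\<forall>i\<in>{1..n}. proj_denom (homology t) (fst c i) > 0"
      using t by (auto simp: S_def homology_domain_def)
    then show "t > 0" "poly E t > 0"
      by (auto simp: poly_E intro!: prod_pos)
    have J: "total_jacobian n (homology t) c = t ^ n / poly E t ^ 3"
      by (simp add: total_jacobian_def det_homology poly_E prod_dividef prod_power_distrib)
    have Jpos: "total_jacobian n (homology t) c > 0"
      unfolding J using \<open>t > 0\<close> \<open>poly E t > 0\<close> by simp
    have curve: "eval_mpoly f (act (homology t) c) = eval_mpoly f (\<gamma> t)" if "local_upto n f" for f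
      unfolding \<gamma>_def by (rule local_uptoD[OF that agree_upto_homology_curve])
    have "eval_mpoly b (act (homology t) c) \<noteq> 0"
      using t PQ'[OF t(1)] by (simp add: curve ab Y_def)
    then have "has_value F (act (homology t) c) (eval_mpoly a (\<gamma> t) / eval_mpoly b (\<gamma> t))"
      using has_value_Fract[of b "act (homology t) c" a] ab by (simp add: curve)
    moreover have "eval_mpoly a (\<gamma> t) / eval_mpoly b (\<gamma> t) = poly X t / poly Y t"
      using PQ[OF t(1)] PQ'[OF t(1)] by (simp add: X_def Y_def)
    moreover have "invertible (homology t)" "\<forall>i\<in>{1..n}. proj_denom (homology t) (fst c i) \<noteq> 0"
      using pos by (force simp: invertible_det_nz det_homology)+
    moreover have "rat_power_defined (total_jacobian n (homology t) c) w"
      using Jpos by (simp add: rat_power_defined_def)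
    ultimately have "poly X t / poly Y t = rat_power (total_jacobian n (homology t) c) w * r"
      using F(1) r(1) unfolding relative_invariant_def by metis
    then show "(poly X t / poly Y t) ^ nat v = (t ^ n / poly E t ^ 3) powi u * r ^ nat v"
      using rat_power_pow_denominator[OF uv Jpos] by (simp add: power_mult_distrib J)
  qed
  \<comment> \<open>Clearing denominators puts the power of \<open>E\<close> on the side that makes all exponents natural.\<close>
  define k where "k = nat \<bar>u\<bar>"
  define G H where "G = (if u \<ge> 0 then E ^ (3 * k) else T ^ (n * k))" and "H = (if u \<ge> 0 then T ^ (n * k) else E ^ (3 * k))"
  have poly_eq: "poly (X ^ nat v * G) t = poly (smult (r ^ nat v) (Y ^ nat v * H)) t" if t: "t \<in> S" "poly Y t \<noteq> 0" for t
  proof (cases "u \<ge> 0")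
    case True
    then have "(t ^ n / poly E t ^ 3) powi u = t ^ (n * k) / poly E t ^ (3 * k)"
      by (simp add: power_int_def k_def power_divide power_mult)
    then show ?thesis
      using identity[OF t] t True by (simp add: G_def H_def T_def power_divide field_simps)
  next
    case False
    then have "(t ^ n / poly E t ^ 3) powi u = poly E t ^ (3 * k) / t ^ (n * k)"
      by (simp add: power_int_def k_def power_divide power_mult)
    then show ?thesis
      using identity[OF t] t False by (simp add: G_def H_def T_def power_divide field_simps)
  qed
  have "X ^ nat v * G = smult (r ^ nat v) (Y ^ nat v * H)" (is "?L = ?R")
  proof (rule ccontr)
    assume "?L \<noteq> ?R"
    then have "\<forall>\<^sub>F t in at 1. poly (?L - ?R) t \<noteq> 0"
      by (intro poly_eventually_nonzero) simp
    with poly_eventually_nonzero[OF XY(2), of 1] eventually_at_in_open'[OF open_homology_domain[of n c] one_in_homology_domain]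
    have "\<forall>\<^sub>F t in at (1::real). False"
      unfolding S_def[symmetric]
      by eventually_elim (use poly_eq in auto)
    then show False
      by simp
  qed
  then have dvd: "int (nat v) dvd int (order s G) - int (order s H)" for s
    using XY ET r(2) by (intro power_factor_order_dvd[of X Y G H "r ^ nat v"]) (auto simp: G_def H_def)
  have order_E: "order s E = (\<Sum>i=1..n. if s = 1 - 1 / x i then 1 else 0)" for s
    unfolding E_def using c(2) by (subst order_prod) (auto simp: order_affine_factor x_def intro!: sum.cong)
  have order_T: "order s T = (if s = 0 then 1 else 0)" for s
    using order_power_n_n[of 0 1] by (auto simp: T_def order_0I)
  have "v dvd int n * u"
  proof -
    have "order 0 E = 0"
      unfolding order_E using c(2) by (auto simp: x_def)
    then have "int (order 0 G) - int (order 0 H) = - (int n * u)"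
      using ET by (auto simp: G_def H_def order_power order_T k_def)
    then show ?thesis
      using dvd[of 0] v by simp
  qed
  moreover have "v dvd 3 * u"
  proof -
    define s where "s = 1 - 1 / x 1"
    have "s \<noteq> 0"
      using c(2) n by (auto simp: s_def x_def field_simps)
    have "order s E = (\<Sum>i=1..n. if i = 1 then 1 else 0)"
      unfolding order_E
    proof (rule sum.cong)
      fix i assume i: "i \<in> {1..n}"
      then have "i = 1 \<or> i \<in> {2..n}"
        by auto
      then have "s = 1 - 1 / x i \<longleftrightarrow> i = 1"
        using c(3) by (auto simp: s_def x_def)
      then show "(if s = 1 - 1 / x i then 1 else 0) = (if i = 1 then 1 else 0 :: nat)"
        by simp
    qed simp
    then have "order s E = 1"
      using n by simp
    then have "int (order s G) - int (order s H) = 3 * u"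
      using ET \<open>s \<noteq> 0\<close> by (auto simp: G_def H_def order_power order_T k_def)
    then show ?thesis
      using dvd[of s] v by simp
  qed
  ultimately have "v dvd int n" "v dvd 3"
    using coprime by (simp_all add: coprime_commute coprime_dvd_mult_left_iff)
  then have "v dvd int (gcd n 3)"
    by (simp add: gcd_int_int_eq[symmetric] del: gcd_int_int_eq)
  then obtain m where m: "int (gcd n 3) = v * m" ..
  have "m \<noteq> 0"
    using m by (metis gcd_eq_0_iff mult_zero_right of_nat_eq_0_iff zero_neq_numeral)
  then have "w = of_int (u * m) / of_int (int (gcd n 3))"
    using v unfolding w m by simp
  then show ?thesis
    by (metis of_int_of_nat_eq)
qed

theorem theorem7:
  fixes n :: nat
  assumes "n \<ge> 3"
  shows "weights n = range (\<lambda>k::int. of_int k / of_nat (gcd n 3)) \<and>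
         relative_invariant_field n = is_subfield hull (insert (z_elem n) (absolute_invariants n))"
proof
  define g where "g = gcd n 3"
  have g: "g = 1 \<or> g = 3"
    by (simp add: g_def gcd_3)
  \<comment> \<open>Translates weights in thirds into weights in multiples of \<open>1 / g\<close>.\<close>
  have scale: "(of_int (int (3 div g) * k) / 3 :: rat) = of_int k / of_nat g" for k
    using g by auto
  have z_power: "relative_invariant n (of_int k / of_nat g) (z_elem n powi (- k))" for k
  proof -
    have "- k * - int (3 div gcd n 3) = int (3 div g) * k"
      by (simp add: g_def)
    then show ?thesis
      using relative_invariant_third_power_int[OF relative_invariant_z_elem z_elem_nonzero, OF assms assms, of "- k"]
      by (simp only: scale)
  qed
  have z_power_nonzero: "z_elem n powi k \<noteq> 0" for k
    using z_elem_nonzero[OF assms] by simp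
  show "weights n = range (\<lambda>k::int. of_int k / of_nat (gcd n 3))"
  proof (intro subset_antisym subsetI)
    fix w assume "w \<in> weights n"
    then show "w \<in> range (\<lambda>k::int. of_int k / of_nat (gcd n 3))"
      using relative_invariant_weight[of n w] assms by (auto simp: weights_def)
  next
    fix w :: rat assume "w \<in> range (\<lambda>k::int. of_int k / of_nat (gcd n 3))"
    then obtain k :: int where "w = of_int k / of_nat g"
      by (auto simp: g_def)
    then have "relative_invariant n w (z_elem n powi (- k))"
      by (simp only: z_power)
    then have "z_elem n powi (- k) \<in> relative_invariant_field n"
      unfolding relative_invariant_field_def by (intro hull_inc CollectI exI)
    then show "w \<in> weights n"
      unfolding weights_def using \<open>relative_invariant n w (z_elem n powi (- k))\<close> z_power_nonzero
      by (intro CollectI bexI conjI)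
  qed
  let ?K = "is_subfield hull (insert (z_elem n) (absolute_invariants n))"
  show "relative_invariant_field n = ?K"
  proof
    have "F \<in> ?K" if F: "relative_invariant n w F" for w F
    proof (cases "F = 0")
      case True
      then show ?thesis
        by (simp add: is_subfield_0 is_subfield_hull)
    next
      case False
      then obtain k :: int where k: "w = of_int k / of_nat g"
        using relative_invariant_weight[OF F] assms by (auto simp: g_def)
      have "relative_invariant n (of_int (int (3 div g) * k) / 3) F"
        using F by (simp only: scale k)
      moreover have "relative_invariant n (of_int (- (int (3 div g) * k)) / 3) (z_elem n powi k)"
        using z_power[of "- k"] unfolding scale[of "- k", symmetric] minus_minus mult_minus_right .
      ultimately have "relative_invariant n 0 (F * z_elem n powi k)"
        using relative_invariant_third_mult by fastforce
      then have "F * z_elem n powi k \<in> ?K"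
        by (auto intro: hull_inc simp: absolute_invariants_def)
      moreover have "z_elem n powi (- k) \<in> ?K"
        by (intro is_subfield_power_int is_subfield_hull) (simp add: hull_inc)
      ultimately have "F * z_elem n powi k * z_elem n powi (- k) \<in> ?K"
        by (rule is_subfield_mult[OF is_subfield_hull])
      moreover have "F * z_elem n powi k * z_elem n powi (- k) = F"
        using z_elem_nonzero[OF assms] by (simp add: power_int_minus)
      ultimately show ?thesis
        by simp
    qed
    then show "relative_invariant_field n \<subseteq> ?K"
      unfolding relative_invariant_field_def by (intro hull_minimal is_subfield_hull) blast
    show "?K \<subseteq> relative_invariant_field n"
      unfolding relative_invariant_field_def absolute_invariants_def
      using relative_invariant_z_elem[OF assms] by (intro hull_mono) blast
  qed
qed

end
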